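(* Let $\{A_\alpha\}_{\alpha\in\Omega},\{\Psi_\alpha\}_{\alpha\in\Omega}$ be in $\mathcal{B}(\mathcal{H},\mathcal{H}_0)$ such that for each $h\in\mathcal{H}$ both maps $\Omega\ni\alpha\mapsto A_\alpha h\in\mathcal{H}_0$ and $\Omega\ni\alpha\mapsto\Psi_\alpha h\in\mathcal{H}_0$ are measurable. Consider the maps $$U:\mathcal{L}^2(\Omega,\mathcal{H}_0)\ni f\mapsto\int_\Omega A_\alpha^*f(\alpha)\,d\mu(\alpha)\in\mathcal{H},\qquad V:\mathcal{L}^2(\Omega,\mathcal{H}_0)\ni g\mapsto\int_\Omega\Psi_\alpha^*g(\alpha)\,d\mu(\alpha)\in\mathcal{H},$$ $$R:\mathcal{H}\ni h\mapsto Rh\in\mathcal{L}^2(\Omega,\mathcal{H}_0),\ (Rh)(\alpha)=A_\alpha h,\qquad S:\mathcal{H}\ni x\mapsto Sx\in\mathcal{L}^2(\Omega,\mathcal{H}_0),\ (Sx)(\alpha)=\Psi_\alpha x.$$ Then $(\{A_\alpha\}_{\alpha\in\Omega},\{\Psi_\alpha\}_{\alpha\in\Omega})$ is a continuous operator-valued frame with bounds $a$ and $b$ (resp. continuous Bessel with bound $b$) (i) if and only if $U$ and $V$ are well-defined, $U,V\in\mathcal{B}(\mathcal{L}^2(\Omega,\mathcal{H}_0),\mathcal{H})$, and $aI_{\mathcal{H}}\le VU^*\le bI_{\mathcal{H}}$ (resp. $0\le VU^*\le bI_{\mathcal{H}}$); (ii) if and only if $U$ and $S$ are well-defined, $U\in\mathcal{B}(\mathcal{L}^2(\Omega,\mathcal{H}_0),\mathcal{H})$,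 $S\in\mathcal{B}(\mathcal{H},\mathcal{L}^2(\Omega,\mathcal{H}_0))$, and $aI_{\mathcal{H}}\le S^*U^*\le bI_{\mathcal{H}}$ (resp. $0\le S^*U^*\le bI_{\mathcal{H}}$); (iii) if and only if $R$ and $V$ are well-defined, $R\in\mathcal{B}(\mathcal{H},\mathcal{L}^2(\Omega,\mathcal{H}_0))$, $V\in\mathcal{B}(\mathcal{L}^2(\Omega,\mathcal{H}_0),\mathcal{H})$, and $aI_{\mathcal{H}}\le VR\le bI_{\mathcal{H}}$ (resp. $0\le VR\le bI_{\mathcal{H}}$); (iv) if and only if $R$ and $S$ are well-defined, $R,S\in\mathcal{B}(\mathcal{H},\mathcal{L}^2(\Omega,\mathcal{H}_0))$, and $aI_{\mathcal{H}}\le S^*R\le bI_{\mathcal{H}}$ (resp. $0\le S^*R\le bI_{\mathcal{H}}$).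
   Context: $\mathcal{H},\mathcal{H}_0$ are Hilbert spaces over $\mathbb{K}\in\{\mathbb{R},\mathbb{C}\}$; $\mathcal{B}(\cdot,\cdot)$ denotes bounded linear operators; $(\Omega,\mu)$ is a measure space with positive measure. All vector-valued integrals are weak: $\int_\Omega F\,d\mu$ is the element of $\mathcal{H}$ with $\langle\int_\Omega F\,d\mu,g\rangle=\int_\Omega\langle F(\alpha),g\rangle\,d\mu(\alpha)$ for all $g\in\mathcal{H}$. Operator inequalities $T_1\le T_2$ mean that the operators are self-adjoint and $T_2-T_1$ is positive. A collection $\{A_\alpha\}_{\alpha\in\Omega}$ in $\mathcal{B}(\mathcal{H},\mathcal{H}_0)$ is a continuous operator-valued frame with respect to $\{\Psi_\alpha\}_{\alpha\in\Omega}$ in $\mathcal{B}(\mathcal{H},\mathcal{H}_0)$ (one says $(\{A_\alpha\}_{\alpha\in\Omega},\{\Psi_\alpha\}_{\alpha\in\Omega})$ is a continuous operator-valued frame) if: (1) for each $h\in\mathcal{H}$ the maps $\alpha\mapsto A_\alpha h$ and $\alpha\mapsto\Psi_\alpha h$ are measurable; (2) the frame operator $S_{A,\Psi}:\mathcal{H}\ni h\mapsto\int_\Omega\Psi_\alpha^*A_\alpha h\,d\mu(\alpha)\in\mathcal{H}$ is a well-defined bounded positive invertible operator; (3) the analysis operators $\theta_A,\theta_\Psi:\mathcal{H}\to\mathcal{L}^2(\Omega,\mathcal{H}_0)$, $(\theta_Ah)(\alpha)=A_\alpha h$, $(\theta_\Psi h)(\alpha)=\Psi_\alpha h$, are well-defined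 bounded linear operators. If in (2) invertibility is dropped (only bounded and positive), the pair is called continuous Bessel. Bounds $a,b>0$ of a frame mean $aI_{\mathcal{H}}\le S_{A,\Psi}\le bI_{\mathcal{H}}$; bound $b$ of a Bessel pair means $0\le S_{A,\Psi}\le bI_{\mathcal{H}}$.
   Formalization: Parts (i)–(iii) are proved for semifinite μ (every set of infinite measure contains a subset of finite positive measure), as they fail without it; (iv) holds for every μ. "Measurable" is read as strongly measurable. *)

theory Defs
  imports "HOL-Analysis.Analysis"
begin

section \<open>The scalar field\<close>

text \<open>
  A uniform treatment of real and complex scalars. Up to isomorphism the real and the complex
  numbers (instances below) are the only models, see \<open>rc_field_real_or_complex\<close>.
\<close>

class rc_field = real_normed_field + banach + second_countable_topology +
  fixes conjK :: "'a \<Rightarrow> 'a"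
    and reK :: "'a \<Rightarrow> real"
  assumes conjK_add: "conjK (x + y) = conjK x + conjK y"
    and conjK_mult: "conjK (x * y) = conjK x * conjK y"
    and conjK_conjK: "conjK (conjK x) = x"
    and add_conjK: "x + conjK x = (2 * reK x) *\<^sub>R 1"
    and mult_conjK: "x * conjK x = (norm x)\<^sup>2 *\<^sub>R 1"

instantiation real :: rc_field
begin
definition conjK_real :: "real \<Rightarrow> real" where "conjK_real x = x"
definition reK_real :: "real \<Rightarrow> real" where "reK_real x = x"
instance
  by standard (simp_all add: conjK_real_def reK_real_def power2_eq_square)
end

instantiation complex :: rc_field
begin
definition conjK_complex :: "complex \<Rightarrow> complex" where "conjK_complex = cnj"
definition reK_complex :: "complex \<Rightarrow> real" where "reK_complex = Re"
instance
proof
  fix x :: complex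
  show "x * conjK x = (norm x)\<^sup>2 *\<^sub>R 1"
    unfolding conjK_complex_def scaleR_conv_of_real
    using complex_norm_square[of x] by simp
qed (simp_all add: conjK_complex_def reK_complex_def complex_eq_iff)
end

lemmas rc_field_of_real = add_conjK[folded of_real_def] mult_conjK[folded of_real_def]

lemma rc_field_real_or_complex:
  "(\<forall>z::'k::rc_field. \<exists>x. z = of_real x) \<or>
   (\<exists>i::'k. i * i = -1 \<and> conjK i = - i \<and> (\<forall>z. \<exists>x y. z = of_real x + of_real y * i))"
proof (cases "\<forall>z::'k. \<exists>x. z = of_real x")
  case False
  define p :: "'k \<Rightarrow> 'k" where "p z = z - of_real (reK z)" for z
  have conj_p: "conjK z - of_real (reK z) = - p z" for z
    using rc_field_of_real(1)[of z] unfolding p_def by (simp add: algebra_simps)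
  have conj0: "conjK (0::'k) = 0"
    using conjK_add[of 0 "0::'k"] by simp
  have fixed: "u = of_real (reK u)" if "conjK u = u" for u :: 'k
  proof -
    have "2 * u = 2 * of_real (reK u)"
      using rc_field_of_real(1)[of u] unfolding that mult_2[symmetric] of_real_mult by simp
    then show ?thesis by (metis mult_cancel_left zero_neq_numeral)
  qed
  have conj_real: "conjK (of_real r :: 'k) = of_real r" for r
  proof -
    have *: "conjK (of_real r) * of_real r = (of_real (r\<^sup>2) :: 'k)"
      using rc_field_of_real(2)[of "of_real r :: 'k"] by (simp add: mult.commute)
    show ?thesis
    proof (cases "r = 0")
      case False
      then show ?thesis using * by (simp add: power2_eq_square)
    qed (simp add: conj0)
  qed
  have conj_p: "conjK (p z) = - p z" for z
    using conj_p[of z] conjK_add[of z "- of_real (reK z)"] conj_real[of "- reK z"]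
    unfolding p_def by simp
  obtain z0 :: 'k where z0: "\<nexists>x. z0 = of_real x" using False by blast
  define w where "w = p z0"
  have w0: "w \<noteq> 0" using z0 unfolding w_def p_def by auto
  define i where "i = w * of_real (1 / norm w)"
  have ww: "w * w = - of_real ((norm w)\<^sup>2)"
    using rc_field_of_real(2)[of w] conj_p[of z0] unfolding w_def
    by (metis minus_mult_right minus_minus)
  have ii: "i * i = -1"
  proof -
    have "i * i = (w * w) * of_real (1 / norm w * (1 / norm w))"
      unfolding i_def by simp
    also have "\<dots> = - of_real ((norm w)\<^sup>2 * (1 / norm w * (1 / norm w)))"
      unfolding ww by simp
    also have "(norm w)\<^sup>2 * (1 / norm w * (1 / norm w)) = 1"
      using w0 by (simp add: power2_eq_square)
    finally show ?thesis by simp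
  qed
  have ci: "conjK i = - i"
    unfolding i_def by (simp only: conjK_mult conj_real) (simp add: w_def conj_p)
  have "\<exists>x y. z = of_real x + of_real y * i" for z
  proof -
    have "conjK (p z * i) = p z * i" by (simp add: conjK_mult conj_p ci)
    then have "p z * i = of_real (reK (p z * i))" by (rule fixed)
    then have "p z * (i * i) = of_real (reK (p z * i)) * i"
      by (metis mult.assoc)
    then have "- p z = of_real (reK (p z * i)) * i"
      unfolding ii mult_minus1_right .
    then have "p z = - (of_real (reK (p z * i)) * i)"
      by (metis minus_minus)
    then have "p z = of_real (- reK (p z * i)) * i"
      unfolding of_real_minus mult_minus_left .
    then have "z = of_real (reK z) + of_real (- reK (p z * i)) * i"
      by (metis p_def add.commute diff_add_cancel)
    then show ?thesis by blast
  qed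
  then show ?thesis using ii ci by blast
qed blast


section \<open>Hilbert spaces and operators\<close>

record ('k, 'v) ip_space =
  vecs :: "'v set"
  vadd :: "'v \<Rightarrow> 'v \<Rightarrow> 'v"
  vscale :: "'k \<Rightarrow> 'v \<Rightarrow> 'v"
  vinner :: "'v \<Rightarrow> 'v \<Rightarrow> 'k"

definition vnorm :: "('k::rc_field, 'v) ip_space \<Rightarrow> 'v \<Rightarrow> real" where
  "vnorm X x = sqrt (reK (vinner X x x))"

text \<open>
  The Hilbert spaces \<open>\<H>\<close>, \<open>\<H>\<^sub>0\<close> are whole types: the class \<^class>\<open>banach\<close> supplies addition,
  norm, topology and completeness, and the record adds the scalar multiplication of the field
  and the inner product, linear in the first argument.
\<close>

locale hilbert_space =
  fixes H :: "('k::rc_field, 'v::banach) ip_space"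
  assumes vecs_UNIV: "vecs H = UNIV"
    and vadd_plus: "vadd H = (+)"
    and vector_space: "vector_space (vscale H)"
    and vscale_of_real: "vscale H (of_real r) x = r *\<^sub>R x"
    and vinner_add: "vinner H (x + y) z = vinner H x z + vinner H y z"
    and vinner_scale: "vinner H (vscale H c x) z = c * vinner H x z"
    and vinner_conj: "vinner H y x = conjK (vinner H x y)"
    and vinner_self: "vinner H x x = of_real ((norm x)\<^sup>2)"

lemma hilbert_space_real:
  "hilbert_space \<lparr>vecs = UNIV, vadd = (+), vscale = (*\<^sub>R),
     vinner = (inner :: 'v::{real_inner, banach} \<Rightarrow> _)\<rparr>"
  by unfold_locales
    (auto simp: conjK_real_def inner_commute power2_norm_eq_inner algebra_simps)

lemma hilbert_space_complex:
  "hilbert_space \<lparr>vecs = UNIV, vadd = (+), vscale = (*), vinner = (\<lambda>x y::complex. x * cnj y)\<rparr>"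
proof unfold_locales
  fix x :: complex
  show "vinner \<lparr>vecs = UNIV, vadd = (+), vscale = (*), vinner = (\<lambda>x y. x * cnj y)\<rparr> x x
        = of_real ((norm x)\<^sup>2)"
    using complex_norm_square[of x] by simp
qed (simp_all add: conjK_complex_def scaleR_conv_of_real algebra_simps)

definition bounded_ops ::
  "('k::rc_field, 'x) ip_space \<Rightarrow> ('k, 'y) ip_space \<Rightarrow> ('x \<Rightarrow> 'y) set" where
  "bounded_ops X Y = {T.
     (\<forall>x\<in>vecs X. T x \<in> vecs Y) \<and>
     (\<forall>x\<in>vecs X. \<forall>x'\<in>vecs X. T (vadd X x x') = vadd Y (T x) (T x')) \<and>
     (\<forall>c. \<forall>x\<in>vecs X. T (vscale X c x) = vscale Y c (T x)) \<and>
     (\<exists>C. \<forall>x\<in>vecs X. vnorm Y (T x) \<le> C * vnorm X x)}"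

definition hadjoint ::
  "('k, 'x) ip_space \<Rightarrow> ('k, 'y) ip_space \<Rightarrow> ('x \<Rightarrow> 'y) \<Rightarrow> 'y \<Rightarrow> 'x" where
  "hadjoint X Y T y =
     (THE x. x \<in> vecs X \<and> (\<forall>x'\<in>vecs X. vinner Y (T x') y = vinner X x' x))"

definition selfadjoint_op :: "('k::rc_field, 'x) ip_space \<Rightarrow> ('x \<Rightarrow> 'x) \<Rightarrow> bool" where
  "selfadjoint_op X T \<longleftrightarrow> T \<in> bounded_ops X X \<and> (\<forall>x\<in>vecs X. hadjoint X X T x = T x)"

text \<open>Over the reals positivity of the quadratic form does not imply self-adjointness, so it is required explicitly.\<close>

definition positive_op :: "('k::rc_field, 'x) ip_space \<Rightarrow> ('x \<Rightarrow> 'x) \<Rightarrow> bool" where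
  "positive_op X T \<longleftrightarrow> selfadjoint_op X T \<and> (\<forall>x\<in>vecs X. 0 \<le> reK (vinner X (T x) x))"

definition invertible_op :: "('k::rc_field, 'x) ip_space \<Rightarrow> ('x \<Rightarrow> 'x) \<Rightarrow> bool" where
  "invertible_op X T \<longleftrightarrow> T \<in> bounded_ops X X \<and>
     (\<exists>T'\<in>bounded_ops X X. \<forall>x\<in>vecs X. T' (T x) = x \<and> T (T' x) = x)"

definition op_le :: "('k::rc_field, 'h::banach) ip_space \<Rightarrow> ('h \<Rightarrow> 'h) \<Rightarrow> ('h \<Rightarrow> 'h) \<Rightarrow> bool" where
  "op_le H T1 T2 \<longleftrightarrow>
     selfadjoint_op H T1 \<and> selfadjoint_op H T2 \<and> positive_op H (\<lambda>h. T2 h - T1 h)"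

definition scalar_op :: "('k::rc_field, 'h) ip_space \<Rightarrow> real \<Rightarrow> 'h \<Rightarrow> 'h" where
  "scalar_op H r = (\<lambda>h. vscale H (of_real r) h)"


section \<open>Vector-valued functions on a measure space\<close>

text \<open>
  Measurability is the strong one (equivalently: Borel measurable with separable range), since in a
  non-separable Hilbert space Borel measurable functions are in general not closed under addition.
  In the separable case it coincides with Borel measurability.
\<close>

definition strongly_measurable :: "'a measure \<Rightarrow> ('a \<Rightarrow> 'v::topological_space) \<Rightarrow> bool" where
  "strongly_measurable M f \<longleftrightarrow>
     (\<exists>s. (\<forall>n::nat. simple_function M (s n)) \<and> (\<forall>\<alpha>\<in>space M. (\<lambda>n. s n \<alpha>) \<longlonglongrightarrow> f \<alpha>))"

text \<open>
  If \<open>\<Omega>\<close> is a single point of infinite measure, then \<open>\<L>\<^sup>2(\<Omega>, \<H>\<^sub>0)\<close> is trivial, so every synthesis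
  operator is well-defined and zero, while \<open>h \<mapsto> A\<^sub>\<alpha> h\<close> is square-integrable only for \<open>A\<^sub>\<alpha> = 0\<close>.
  Characterizing frames by synthesis operators therefore needs semifiniteness
  (which \<open>\<sigma>\<close>-finiteness implies).
\<close>

definition semifinite :: "'a measure \<Rightarrow> bool" where
  "semifinite M \<longleftrightarrow> (\<forall>E\<in>sets M. emeasure M E = \<infinity> \<longrightarrow>
     (\<exists>D\<in>sets M. D \<subseteq> E \<and> 0 < emeasure M D \<and> emeasure M D < \<infinity>))"

definition has_weak_integral ::
  "'a measure \<Rightarrow> ('k::rc_field, 'h) ip_space \<Rightarrow> ('a \<Rightarrow> 'h) \<Rightarrow> 'h \<Rightarrow> bool" where
  "has_weak_integral M H F v \<longleftrightarrow> v \<in> vecs H \<and>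
     (\<forall>g\<in>vecs H. integrable M (\<lambda>\<alpha>. vinner H (F \<alpha>) g) \<and>
                  vinner H v g = (LINT \<alpha>|M. vinner H (F \<alpha>) g))"

text \<open>
  \<open>L2_space M H0\<close> is the space \<open>\<L>\<^sup>2(\<Omega>, \<H>\<^sub>0)\<close>; its vectors are classes of square-integrable functions
  modulo equality almost everywhere.
\<close>

definition square_integrable :: "'a measure \<Rightarrow> ('a \<Rightarrow> 'v::real_normed_vector) set" where
  "square_integrable M =
     {f. strongly_measurable M f \<and> integrable M (\<lambda>\<alpha>. (norm (f \<alpha>))\<^sup>2)}"

definition ae_rel :: "'a measure \<Rightarrow> (('a \<Rightarrow> 'v::real_normed_vector) \<times> ('a \<Rightarrow> 'v)) set" where
  "ae_rel M = {(f, g). f \<in> square_integrable M \<and> g \<in> square_integrable M \<and>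
                        (AE \<alpha> in M. f \<alpha> = g \<alpha>)}"

definition L2_class :: "'a measure \<Rightarrow> ('a \<Rightarrow> 'v::real_normed_vector) \<Rightarrow> ('a \<Rightarrow> 'v) set" where
  "L2_class M f = ae_rel M `` {f}"

definition L2_space ::
  "'a measure \<Rightarrow> ('k::rc_field, 'v::banach) ip_space \<Rightarrow> ('k, ('a \<Rightarrow> 'v) set) ip_space" where
  "L2_space M H0 = \<lparr>
     vecs = square_integrable M // ae_rel M,
     vadd = (\<lambda>F G. \<Union>f\<in>F. \<Union>g\<in>G. L2_class M (\<lambda>\<alpha>. f \<alpha> + g \<alpha>)),
     vscale = (\<lambda>c F. \<Union>f\<in>F. L2_class M (\<lambda>\<alpha>. vscale H0 c (f \<alpha>))),
     vinner = (\<lambda>F G. THE z. \<forall>f\<in>F. \<forall>g\<in>G. z = (LINT \<alpha>|M. vinner H0 (f \<alpha>) (g \<alpha>)))\<rparr>"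


section \<open>Continuous operator-valued frames\<close>

text \<open>
  \<open>analysis_op M A\<close> is the map \<open>h \<mapsto> (A\<^sub>\<alpha> h)\<^sub>\<alpha>\<close> into \<open>\<L>\<^sup>2\<close>, and \<open>synthesis_op M H H0 A\<close> is
  the map \<open>f \<mapsto> \<integral> A\<^sub>\<alpha>\<^sup>* f(\<alpha>) d\<mu>(\<alpha>)\<close> on \<open>\<L>\<^sup>2\<close>. As these are total functions here, being well-defined
  is a separate predicate.
\<close>

definition analysis_wd :: "'a measure \<Rightarrow> ('a \<Rightarrow> 'h \<Rightarrow> 'v::banach) \<Rightarrow> bool" where
  "analysis_wd M A \<longleftrightarrow> (\<forall>h. (\<lambda>\<alpha>. A \<alpha> h) \<in> square_integrable M)"

definition analysis_op :: "'a measure \<Rightarrow> ('a \<Rightarrow> 'h \<Rightarrow> 'v::banach) \<Rightarrow> 'h \<Rightarrow> ('a \<Rightarrow> 'v) set" where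
  "analysis_op M A h = L2_class M (\<lambda>\<alpha>. A \<alpha> h)"

definition synthesis_wd ::
  "'a measure \<Rightarrow> ('k::rc_field, 'h::banach) ip_space \<Rightarrow> ('k, 'v::banach) ip_space \<Rightarrow>
   ('a \<Rightarrow> 'h \<Rightarrow> 'v) \<Rightarrow> bool" where
  "synthesis_wd M H H0 A \<longleftrightarrow> (\<forall>F\<in>vecs (L2_space M H0).
     \<exists>!v. \<forall>f\<in>F. has_weak_integral M H (\<lambda>\<alpha>. hadjoint H H0 (A \<alpha>) (f \<alpha>)) v)"

definition synthesis_op ::
  "'a measure \<Rightarrow> ('k::rc_field, 'h::banach) ip_space \<Rightarrow> ('k, 'v::banach) ip_space \<Rightarrow>
   ('a \<Rightarrow> 'h \<Rightarrow> 'v) \<Rightarrow> ('a \<Rightarrow> 'v) set \<Rightarrow> 'h" where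
  "synthesis_op M H H0 A F =
     (THE v. \<forall>f\<in>F. has_weak_integral M H (\<lambda>\<alpha>. hadjoint H H0 (A \<alpha>) (f \<alpha>)) v)"

definition frame_op_wd ::
  "'a measure \<Rightarrow> ('k::rc_field, 'h::banach) ip_space \<Rightarrow> ('k, 'v::banach) ip_space \<Rightarrow>
   ('a \<Rightarrow> 'h \<Rightarrow> 'v) \<Rightarrow> ('a \<Rightarrow> 'h \<Rightarrow> 'v) \<Rightarrow> bool" where
  "frame_op_wd M H H0 A \<Psi> \<longleftrightarrow>
     (\<forall>h. \<exists>!v. has_weak_integral M H (\<lambda>\<alpha>. hadjoint H H0 (\<Psi> \<alpha>) (A \<alpha> h)) v)"

definition frame_op ::
  "'a measure \<Rightarrow> ('k::rc_field, 'h::banach) ip_space \<Rightarrow> ('k, 'v::banach) ip_space \<Rightarrow>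
   ('a \<Rightarrow> 'h \<Rightarrow> 'v) \<Rightarrow> ('a \<Rightarrow> 'h \<Rightarrow> 'v) \<Rightarrow> 'h \<Rightarrow> 'h" where
  "frame_op M H H0 A \<Psi> h =
     (THE v. has_weak_integral M H (\<lambda>\<alpha>. hadjoint H H0 (\<Psi> \<alpha>) (A \<alpha> h)) v)"

definition measurable_op_family ::
  "'a measure \<Rightarrow> ('k::rc_field, 'h::banach) ip_space \<Rightarrow> ('k, 'v::banach) ip_space \<Rightarrow>
   ('a \<Rightarrow> 'h \<Rightarrow> 'v) \<Rightarrow> bool" where
  "measurable_op_family M H H0 A \<longleftrightarrow>
     (\<forall>\<alpha>\<in>space M. A \<alpha> \<in> bounded_ops H H0) \<and> (\<forall>h. strongly_measurable M (\<lambda>\<alpha>. A \<alpha> h))"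

definition continuous_bessel ::
  "'a measure \<Rightarrow> ('k::rc_field, 'h::banach) ip_space \<Rightarrow> ('k, 'v::banach) ip_space \<Rightarrow>
   ('a \<Rightarrow> 'h \<Rightarrow> 'v) \<Rightarrow> ('a \<Rightarrow> 'h \<Rightarrow> 'v) \<Rightarrow> bool" where
  "continuous_bessel M H H0 A \<Psi> \<longleftrightarrow>
     measurable_op_family M H H0 A \<and> measurable_op_family M H H0 \<Psi> \<and>
     frame_op_wd M H H0 A \<Psi> \<and>
     frame_op M H H0 A \<Psi> \<in> bounded_ops H H \<and> positive_op H (frame_op M H H0 A \<Psi>) \<and>
     analysis_wd M A \<and> analysis_op M A \<in> bounded_ops H (L2_space M H0) \<and>
     analysis_wd M \<Psi> \<and> analysis_op M \<Psi> \<in> bounded_ops H (L2_space M H0)"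

definition continuous_ovf ::
  "'a measure \<Rightarrow> ('k::rc_field, 'h::banach) ip_space \<Rightarrow> ('k, 'v::banach) ip_space \<Rightarrow>
   ('a \<Rightarrow> 'h \<Rightarrow> 'v) \<Rightarrow> ('a \<Rightarrow> 'h \<Rightarrow> 'v) \<Rightarrow> bool" where
  "continuous_ovf M H H0 A \<Psi> \<longleftrightarrow>
     continuous_bessel M H H0 A \<Psi> \<and> invertible_op H (frame_op M H H0 A \<Psi>)"

definition continuous_bessel_bound ::
  "'a measure \<Rightarrow> ('k::rc_field, 'h::banach) ip_space \<Rightarrow> ('k, 'v::banach) ip_space \<Rightarrow>
   ('a \<Rightarrow> 'h \<Rightarrow> 'v) \<Rightarrow> ('a \<Rightarrow> 'h \<Rightarrow> 'v) \<Rightarrow> real \<Rightarrow> bool" where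
  "continuous_bessel_bound M H H0 A \<Psi> b \<longleftrightarrow> continuous_bessel M H H0 A \<Psi> \<and>
     op_le H (\<lambda>_. 0) (frame_op M H H0 A \<Psi>) \<and> op_le H (frame_op M H H0 A \<Psi>) (scalar_op H b)"

definition continuous_ovf_bounds ::
  "'a measure \<Rightarrow> ('k::rc_field, 'h::banach) ip_space \<Rightarrow> ('k, 'v::banach) ip_space \<Rightarrow>
   ('a \<Rightarrow> 'h \<Rightarrow> 'v) \<Rightarrow> ('a \<Rightarrow> 'h \<Rightarrow> 'v) \<Rightarrow> real \<Rightarrow> real \<Rightarrow> bool" where
  "continuous_ovf_bounds M H H0 A \<Psi> a b \<longleftrightarrow> continuous_ovf M H H0 A \<Psi> \<and>
     op_le H (scalar_op H a) (frame_op M H H0 A \<Psi>) \<and>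
     op_le H (frame_op M H H0 A \<Psi>) (scalar_op H b)"

end

theory Submission
  imports Defs
begin

text \<open>
  Everything reduces to (iv). By Riesz, bounded analysis operators have everywhere defined weak
  synthesis integrals, \<open>\<langle>U f, g\<rangle> = \<integral> \<langle>f(\<alpha>), A\<^sub>\<alpha> g\<rangle> d\<mu>\<close>, so that \<open>U = R\<^sup>*\<close>, \<open>V = S\<^sup>*\<close> and the frame operator is
  \<open>V R\<close>. Conversely, if \<open>U\<close> is bounded, testing against truncations of \<open>\<alpha> \<mapsto> A\<^sub>\<alpha> h\<close>, supported on sets
  of finite measure by semifiniteness, bounds its \<open>\<L>\<^sup>2\<close> norm. The lower bound \<open>a I \<le> V R\<close> makes the
  frame operator invertible by Lax--Milgram.
\<close>

section \<open>Scalars and the Riesz representation\<close>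

text \<open>The passage from synthesis to analysis has a circularity to break: until \<alpha>
  \<mapsto> \<open>A \<alpha> h\<close> is known to be square-integrable, it is not an admissible
  argument of \<open>U\<close>, so the inequality that would bound its norm cannot be stated for it.
  Truncations are admissible on sets of finite measure, but semifiniteness as defined yields only
  one subset of positive finite measure; an exhaustion argument turns this into a finiteness
  criterion for whole sets. A second constraint is that the scalars are real or complex while the
  vectors come from the class \<open>banach\<close>. Existence results are obtained by minimizing an
  energy over the reals, and homogeneity in the scalars recovers the full identity from its real
  part. Finally, adjoints and synthesis operators are definite descriptions, which say nothing
  before existence and uniqueness are shown. The adjoints to and from \<open>L2_space M H0\<close>
  are exhibited as concrete operators, with uniqueness checked separately.\<close>

lemma conjK_zero [simp]: "conjK (0::'k::rc_field) = 0"
  using conjK_add[of 0 "0::'k"] by simp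

lemma conjK_of_real [simp]: "conjK (of_real r :: 'k::rc_field) = of_real r"
proof (cases "r = 0")
  case False
  have "of_real r * conjK (of_real r) = (of_real r * of_real r :: 'k)"
    using rc_field_of_real(2)[of "of_real r :: 'k"] by (simp add: power2_eq_square)
  then show ?thesis using False by simp
qed simp

lemma norm_conjK [simp]: "norm (conjK x :: 'k::rc_field) = norm x"
proof (cases "x = 0")
  case False
  have "norm x * norm (conjK x) = norm x * norm x"
    using arg_cong[OF rc_field_of_real(2)[of x], of norm]
    by (simp add: norm_mult power2_eq_square abs_mult)
  then show ?thesis using False by simp
qed simp

text \<open>\<open>reK\<close> is specified only through \<open>x + conjK x\<close>, so facts about
  it are proved after embedding into the field and then read off by injectivity of
  \<open>of_real\<close>.\<close>

lemma of_real_reK: "of_real (2 * reK x) = x + conjK (x::'k::rc_field)"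
  using rc_field_of_real(1)[of x] by simp

lemma reK_of_real [simp]: "reK (of_real r :: 'k::rc_field) = r"
proof -
  have "of_real (2 * reK (of_real r :: 'k)) = (of_real (2 * r) :: 'k)"
    by (subst of_real_reK) simp
  then show ?thesis by (simp only: of_real_eq_iff)
qed

lemma conjK_mult_self: "conjK x * x = of_real ((norm (x::'k::rc_field))\<^sup>2)"
  by (metis mult.commute rc_field_of_real(2))

lemma reK_of_real_power [simp]: "reK (of_real r ^ n :: 'k::rc_field) = r ^ n"
  by (metis of_real_power reK_of_real)

lemma reK_add: "reK (x + y :: 'k::rc_field) = reK x + reK y"
proof -
  have "of_real (2 * reK (x + y)) = (of_real (2 * reK x + 2 * reK y) :: 'k)"
    unfolding of_real_add of_real_reK conjK_add by (simp add: algebra_simps)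
  then show ?thesis by (simp only: of_real_eq_iff)
qed

lemma reK_conjK [simp]: "reK (conjK x :: 'k::rc_field) = reK x"
proof -
  have "of_real (2 * reK (conjK x)) = (of_real (2 * reK x) :: 'k)"
    unfolding of_real_reK conjK_conjK by (simp add: algebra_simps)
  then show ?thesis by (simp only: of_real_eq_iff)
qed

lemma abs_reK_le: "\<bar>reK x\<bar> \<le> norm (x::'k::rc_field)"
proof -
  have "norm (of_real (2 * reK x) :: 'k) \<le> norm x + norm x"
    unfolding of_real_reK using norm_triangle_ineq[of x "conjK x"] by simp
  then show ?thesis by simp
qed

lemma bounded_linear_conjK: "bounded_linear (conjK :: 'k::rc_field \<Rightarrow> 'k)"
  by (rule bounded_linear_intro[of _ 1]) (simp_all add: conjK_add conjK_mult scaleR_conv_of_real)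

lemma reK_scaleR: "reK (r *\<^sub>R x :: 'k::rc_field) = r * reK x"
proof -
  have "of_real (2 * reK (r *\<^sub>R x)) = (of_real r * of_real (2 * reK x) :: 'k)"
    unfolding of_real_reK scaleR_conv_of_real conjK_mult by (simp add: algebra_simps)
  then have "of_real (2 * reK (r *\<^sub>R x)) = (of_real (2 * (r * reK x)) :: 'k)"
    by (simp add: algebra_simps)
  then show ?thesis by (simp only: of_real_eq_iff)
qed

lemma bounded_linear_reK: "bounded_linear (reK :: 'k::rc_field \<Rightarrow> real)"
  by (rule bounded_linear_intro[of _ 1]) (simp_all add: reK_add reK_scaleR abs_reK_le)

lemma reK_diff: "reK (x - y :: 'k::rc_field) = reK x - reK y"
  by (rule linear_diff[OF bounded_linear.linear[OF bounded_linear_reK]])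

section \<open>Minimization of a coercive quadratic energy\<close>

text \<open>The minimizer of the energy \<open>B x x - 2 * f x\<close> solves the variational equation.\<close>

lemma symmetric_Lax_Milgram:
  fixes B :: "'v::banach \<Rightarrow> 'v \<Rightarrow> real"
  assumes "bounded_bilinear B" and sym: "\<And>x y. B x y = B y x"
    and c: "0 < c" "\<And>x. c * (norm x)\<^sup>2 \<le> B x x"
    and f: "bounded_linear f"
  shows "\<exists>x. \<forall>y. B x y = f y"
proof -
  interpret B: bounded_bilinear B by fact
  interpret f: bounded_linear f by fact
  define J where "J x = B x x - 2 * f x" for x
  obtain K where K: "\<And>x. \<bar>f x\<bar> \<le> norm x * K" using f.bounded by auto
  \<comment> \<open>Completing the square: with t = \<open>norm x\<close>, the lower estimate c t^2
    - 2 K t is smallest at t = K / c, where it equals - K^2 / c.\<close>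
  have low: "- (K\<^sup>2 / c) \<le> J x" for x
  proof -
    have "0 \<le> (c * norm x - K)\<^sup>2 / c" using c by simp
    also have "\<dots> = c * (norm x)\<^sup>2 - 2 * (norm x * K) + K\<^sup>2 / c"
      using c by (simp add: power2_eq_square field_simps)
    finally show ?thesis using c(2)[of x] K[of x] unfolding J_def by linarith
  qed
  define d where "d = (INF x. J x)"
  have bdd: "bdd_below (range J)" using low by (auto intro!: bdd_belowI)
  have d: "d \<le> J x" for x unfolding d_def using bdd by (intro cINF_lower) auto
  have "\<exists>x. J x < d + 1 / real (Suc n)" for n
    using cINF_less_iff[OF _ bdd, of "d + 1 / real (Suc n)"] unfolding d_def by auto
  then obtain s where s: "\<And>n. J (s n) < d + 1 / real (Suc n)" by metis
  \<comment> \<open>Parallelogram identity for \<open>J\<close>: the linear parts cancel against the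
    midpoint, whose energy is at least \<open>d\<close>. Hence almost minimal points lie close
    together.\<close>
  have para: "c * (dist x y)\<^sup>2 \<le> 2 * (J x + J y - 2 * d)" for x y
  proof -
    have "J x + J y - 2 * J ((1/2) *\<^sub>R (x + y)) = B (x - y) (x - y) / 2"
      unfolding J_def using sym[of x y]
      by (simp add: B.scaleR_left B.scaleR_right B.add_left B.add_right B.diff_left B.diff_right
          f.scaleR f.add field_simps)
    then show ?thesis using c(2)[of "x - y"] d[of "(1/2) *\<^sub>R (x + y)"] by (simp add: dist_norm)
  qed
  have "Cauchy s"
  proof (rule metric_CauchyI)
    fix e :: real assume e: "0 < e"
    \<comment> \<open>In \<open>para\<close>, two energies exceeding \<open>d\<close> by less than c
      e^2 / 4 give a bound below 2 (c e^2 / 4 + c e^2 / 4) = c e^2.\<close>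
    then have "0 < c * e\<^sup>2 / 4" using c by simp
    then obtain N where N: "1 / real (Suc N) < c * e\<^sup>2 / 4" using nat_approx_posE by blast
    have "dist (s m) (s n) < e" if "m \<ge> N" "n \<ge> N" for m n
    proof -
      have m: "1 / real (Suc m) \<le> 1 / real (Suc N)" "1 / real (Suc n) \<le> 1 / real (Suc N)"
        using that by (simp_all add: field_simps)
      have "J (s m) < d + c * e\<^sup>2 / 4" "J (s n) < d + c * e\<^sup>2 / 4"
        using order_less_trans[OF order_less_le_trans[OF s add_left_mono[OF m(1)]] add_strict_left_mono[OF N]]
          order_less_trans[OF order_less_le_trans[OF s add_left_mono[OF m(2)]] add_strict_left_mono[OF N]] .
      then have "c * (dist (s m) (s n))\<^sup>2 < c * e\<^sup>2"
        using para[of "s m" "s n"] by (simp add: algebra_simps)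
      then have "(dist (s m) (s n))\<^sup>2 < e\<^sup>2" using c by simp
      then show ?thesis using e by (meson less_imp_le power_less_imp_less_base)
    qed
    then show "\<exists>N. \<forall>m\<ge>N. \<forall>n\<ge>N. dist (s m) (s n) < e" by blast
  qed
  then obtain x where x: "s \<longlonglongrightarrow> x" using Cauchy_convergent convergent_def by blast
  have "(\<lambda>n. J (s n)) \<longlonglongrightarrow> J x" unfolding J_def
    by (intro tendsto_intros B.tendsto f.tendsto x)
  moreover have "(\<lambda>n. d + 1 / real (Suc n)) \<longlonglongrightarrow> d + 0"
    by (intro tendsto_intros LIMSEQ_Suc[OF lim_1_over_n])
  ultimately have "J x \<le> d + 0" by (rule LIMSEQ_le) (use s less_imp_le in blast)
  then have min: "J x \<le> J y" for y using d[of y] by simp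
  have "B x y = f y" for y
  proof -
    \<comment> \<open>Twice \<open>p\<close> is the derivative of t \<mapsto>
      \<open>J (x + t *\<^sub>R y)\<close> at t = 0.\<close>
    define p where "p = B x y - f y"
    have q: "0 \<le> 2 * t * p + t\<^sup>2 * B y y" for t
    proof -
      have "J (x + t *\<^sub>R y) - J x = 2 * t * p + t\<^sup>2 * B y y" unfolding J_def p_def using sym[of x y]
        by (simp add: B.scaleR_left B.scaleR_right B.add_left B.add_right f.scaleR f.add
            algebra_simps power2_eq_square)
      then show ?thesis using min[of "x + t *\<^sub>R y"] by simp
    qed
    have b: "0 \<le> B y y" using c by (meson order_trans mult_nonneg_nonneg less_imp_le zero_le_power2)
    \<comment> \<open>The quadratic is minimal at t = - p / \<open>B y y\<close>; adding 1 to the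
      denominator excludes division by 0 and still gives a negative value unless p = 0.\<close>
    have "0 \<le> 2 * (- p / (1 + B y y)) * p + (- p / (1 + B y y))\<^sup>2 * B y y" by (rule q)
    also have "\<dots> = - (p\<^sup>2 * (2 + B y y) / (1 + B y y)\<^sup>2)" using b
      by (simp add: field_simps power2_eq_square add_nonneg_eq_0_iff)
    finally have "p\<^sup>2 * (2 + B y y) / (1 + B y y)\<^sup>2 \<le> 0" by simp
    moreover have "0 < p\<^sup>2 * (2 + B y y) / (1 + B y y)\<^sup>2" if "p \<noteq> 0"
      using that b by (intro divide_pos_pos mult_pos_pos) auto
    ultimately show ?thesis unfolding p_def by fastforce
  qed
  then show ?thesis by blast
qed

section \<open>Inner product geometry, Riesz representation and invertibility\<close>

context hilbert_space begin

lemma vinner_add_right: "vinner H x (y + z) = vinner H x y + vinner H x z"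
  by (metis vinner_add vinner_conj conjK_add)

lemma vinner_scale_right: "vinner H x (vscale H c y) = conjK c * vinner H x y"
  by (metis vinner_scale vinner_conj conjK_mult)

text \<open>The locale ties \<open>vscale\<close> to the norm of the type class only for real
  scalars; for the others homogeneity comes out of the inner product.\<close>

lemma norm_vscale: "norm (vscale H c x) = norm c * norm x"
proof -
  have "of_real ((norm (vscale H c x))\<^sup>2) = (of_real ((norm c * norm x)\<^sup>2) :: 'k)"
    unfolding vinner_self[symmetric] vinner_scale vinner_scale_right
    by (simp add: vinner_self power_mult_distrib conjK_mult_self flip: mult.assoc)
  then have "(norm (vscale H c x))\<^sup>2 = (norm c * norm x)\<^sup>2" by (simp only: of_real_eq_iff)
  then show ?thesis by (metis norm_ge_zero mult_nonneg_nonneg power2_eq_imp_eq)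
qed

lemma vinner_scaleR: "vinner H (r *\<^sub>R x) y = r *\<^sub>R vinner H x y"
  by (metis vinner_scale vscale_of_real scaleR_conv_of_real)

lemma vinner_scaleR_right: "vinner H x (r *\<^sub>R y) = r *\<^sub>R vinner H x y"
  by (metis vinner_scale_right vscale_of_real scaleR_conv_of_real conjK_of_real)

lemma norm_add_square: "(norm (x + y))\<^sup>2 = (norm x)\<^sup>2 + 2 * reK (vinner H x y) + (norm y)\<^sup>2"
proof -
  have *: "(norm z)\<^sup>2 = reK (vinner H z z)" for z by (simp add: vinner_self)
  show ?thesis unfolding *
    using vinner_conj[of y x] by (simp add: vinner_add vinner_add_right reK_add)
qed

text \<open>The usual order is reversed: the triangle inequality is given with the type class, and
  expanding both squares turns it into the real part of Cauchy--Schwarz.\<close>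

lemma reK_vinner_le: "reK (vinner H x y) \<le> norm x * norm y"
proof -
  have "(norm (x + y))\<^sup>2 \<le> (norm x + norm y)\<^sup>2" by (simp add: norm_triangle_ineq power_mono)
  then show ?thesis unfolding norm_add_square by (simp add: power2_eq_square algebra_simps)
qed

text \<open>Scaling \<open>x\<close> by the conjugate of the inner product makes the new inner
  product real and nonnegative, so the estimate of real parts applies; the extra factor
  cancels.\<close>

lemma norm_vinner_le: "norm (vinner H x y) \<le> norm x * norm y"
proof (cases "vinner H x y = 0")
  case False
  let ?z = "vinner H x y"
  have "vinner H (vscale H (conjK ?z) x) y = of_real ((norm ?z)\<^sup>2)"
    by (simp add: vinner_scale conjK_mult_self)
  then have "(norm ?z)\<^sup>2 \<le> norm (vscale H (conjK ?z) x) * norm y"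
    using reK_vinner_le[of "vscale H (conjK ?z) x" y] by simp
  then show ?thesis using False by (simp add: norm_vscale power2_eq_square mult.assoc)
qed simp

lemma bounded_bilinear_vinner: "bounded_bilinear (vinner H)"
  by standard (auto simp: vinner_add vinner_add_right vinner_scaleR vinner_scaleR_right
      intro!: exI[of _ 1] norm_vinner_le)

sublocale vinner: bounded_bilinear "vinner H" by (rule bounded_bilinear_vinner)

lemma vinner_eqI:
  assumes "\<And>x. vinner H x y = vinner H x z" shows "y = z"
proof -
  have "vinner H (y - z) (y - z) = 0" using assms by (simp add: vinner.diff_right)
  then show ?thesis by (simp add: vinner_self)
qed

lemma vinner_eqI':
  assumes "\<And>x. vinner H y x = vinner H z x" shows "y = z"
  by (rule vinner_eqI) (metis assms vinner_conj)

text \<open>Scaling \<open>x\<close> by the conjugate of the difference \<open>f x - g x\<close>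
  turns the real part of the difference into its squared modulus.\<close>

lemma reK_eq_imp_eq:
  assumes "\<And>c x. f (vscale H c x) = c * f x" "\<And>c x. g (vscale H c x) = c * g x"
    and "\<And>x. reK (f x) = reK (g x)"
  shows "f x = g x"
proof -
  let ?z = "f x - g x"
  have "reK (conjK ?z * ?z) = 0"
    using assms(3)[of "vscale H (conjK ?z) x"] by (simp add: assms algebra_simps reK_diff)
  then show ?thesis by (simp add: conjK_mult_self)
qed

text \<open>For a positive definite \<open>T\<close> this also yields surjectivity of \<open>T\<close>; the Riesz
  representation theorem is the case of the identity.\<close>

lemma coercive_representation:
  assumes T: "\<And>x y. T (x + y) = T x + T y" "\<And>c x. T (vscale H c x) = vscale H c (T x)"
      "\<And>x. norm (T x) \<le> C * norm x" "\<And>x y. vinner H (T x) y = vinner H x (T y)"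
    and c: "0 < c" "\<And>x. c * (norm x)\<^sup>2 \<le> reK (vinner H (T x) x)"
    and f: "\<And>x y. f (x + y) = f x + f y" "\<And>c x. f (vscale H c x) = c * f x"
      "\<And>x. norm (f x) \<le> D * norm x"
  shows "\<exists>z. \<forall>x. f x = vinner H x (T z)"
proof -
  have TR: "bounded_linear T"
    by (rule bounded_linear_intro[of _ C])
      (use T in \<open>simp_all add: mult.commute flip: vscale_of_real\<close>)
  have fR: "bounded_linear f"
    by (rule bounded_linear_intro[of _ D])
      (use f in \<open>simp_all add: mult.commute scaleR_conv_of_real flip: vscale_of_real\<close>)
  \<comment> \<open>Over the reals \<open>reK (vinner H (T x) y)\<close> is a symmetric coercive
    form. This represents only the real part of \<open>f\<close>; homogeneity over the whole field
    then gives the rest.\<close>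
  have "\<exists>z. \<forall>x. reK (vinner H (T z) x) = reK (f x)"
  proof (rule symmetric_Lax_Milgram)
    show "bounded_bilinear (\<lambda>x y. reK (vinner H (T x) y))"
    proof -
      interpret VT: bounded_bilinear "\<lambda>x y. vinner H (T x) y"
        by (rule bounded_bilinear.comp1[OF bounded_bilinear_vinner TR])
      obtain K where K: "\<And>x y. norm (vinner H (T x) y) \<le> norm x * norm y * K"
        using VT.bounded by blast
      show ?thesis
      proof unfold_locales
        show "\<exists>K. \<forall>x y. norm (reK (vinner H (T x) y)) \<le> norm x * norm y * K"
          using order_trans[OF abs_reK_le K] by auto
      qed (simp_all add: VT.add_left VT.add_right VT.scaleR_left VT.scaleR_right reK_add reK_scaleR)
    qed
    show "reK (vinner H (T x) y) = reK (vinner H (T y) x)" for x y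
      by (metis T(4) vinner_conj reK_conjK)
    show "bounded_linear (\<lambda>x. reK (f x))"
      by (rule bounded_linear_compose[OF bounded_linear_reK fR])
  qed (use c in auto)
  then obtain z where z: "\<And>x. reK (vinner H (T z) x) = reK (f x)" by blast
  have "f x = vinner H x (T z)" for x
  proof (rule reK_eq_imp_eq[of f "\<lambda>x. vinner H x (T z)"])
    show "reK (f x) = reK (vinner H x (T z))" for x
      using z[of x] vinner_conj[of x "T z"] by simp
  qed (simp_all add: f vinner_scale)
  then show ?thesis by blast
qed

lemma riesz_representation:
  assumes "\<And>x y. f (x + y) = f x + f y" "\<And>c x. f (vscale H c x) = c * f x"
      "\<And>x. norm (f x) \<le> D * norm x"
  shows "\<exists>z. \<forall>x. f x = vinner H x z"
  by (rule coercive_representation[of "\<lambda>x. x" 1 1 f D]) (use assms in \<open>auto simp: vinner_self\<close>)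

lemma vnorm_eq: "vnorm H x = norm x"
  by (simp add: vnorm_def vinner_self)

lemma bounded_ops_iff:
  "T \<in> bounded_ops H H \<longleftrightarrow> (\<forall>x y. T (x + y) = T x + T y) \<and>
     (\<forall>c x. T (vscale H c x) = vscale H c (T x)) \<and> (\<exists>C. \<forall>x. norm (T x) \<le> C * norm x)"
  by (simp add: bounded_ops_def vecs_UNIV vadd_plus vnorm_eq)

text \<open>The description has at most one value because the inner product of \<open>H\<close>
  separates points of \<open>H\<close>; the target \<open>Y\<close> may therefore also be the
  quotient record \<open>L2_space M H0\<close>.\<close>

lemma hadjoint_eqI:
  assumes "\<And>x. vinner Y (T x) y = vinner H x z"
  shows "hadjoint H Y T y = z"
  unfolding hadjoint_def using assms by (intro the_equality) (auto simp: vecs_UNIV intro: vinner_eqI)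

text \<open>\<open>selfadjoint_op\<close> equates \<open>T x\<close> with a definite description,
  which carries information only once Riesz has supplied an adjoint vector.\<close>

lemma selfadjointD:
  assumes "selfadjoint_op H T" shows "vinner H (T x) y = vinner H x (T y)"
proof -
  from assms obtain C where T: "\<And>x y. T (x + y) = T x + T y" "\<And>c x. T (vscale H c x) = vscale H c (T x)"
      "\<And>x. norm (T x) \<le> C * norm x"
    unfolding selfadjoint_op_def bounded_ops_iff by blast
  have "\<exists>z. \<forall>x. vinner H (T x) y = vinner H x z"
  proof (rule riesz_representation)
    show "norm (vinner H (T x) y) \<le> (C * norm y) * norm x" for x
      using norm_vinner_le[of "T x" y] mult_right_mono[OF T(3)[of x], of "norm y"]
      by (simp add: algebra_simps)
  qed (simp_all add: T vinner_add vinner_scale)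
  then obtain z where z: "\<And>x. vinner H (T x) y = vinner H x z" by blast
  then have "hadjoint H H T y = z" by (rule hadjoint_eqI)
  moreover have "hadjoint H H T y = T y" using assms by (simp add: selfadjoint_op_def vecs_UNIV)
  ultimately show ?thesis using z by simp
qed

text \<open>Coercivity and Cauchy--Schwarz bound \<open>T\<close> from below, hence injectivity.
  Surjectivity comes from representing the functional \<open>\<lambda>x. vinner H x y\<close> by a
  vector of the form \<open>T z\<close>, which must equal \<open>y\<close>.\<close>

lemma selfadjoint_coercive_invertible:
  assumes T: "selfadjoint_op H T" and a: "0 < a" "\<And>x. a * (norm x)\<^sup>2 \<le> reK (vinner H (T x) x)"
  shows "invertible_op H T"
proof -
  from T have Tb: "T \<in> bounded_ops H H" by (simp add: selfadjoint_op_def)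
  then obtain C where lin: "\<And>x y. T (x + y) = T x + T y"
      "\<And>c x. T (vscale H c x) = vscale H c (T x)" "\<And>x. norm (T x) \<le> C * norm x"
    unfolding bounded_ops_iff by blast
  have low: "a * norm x \<le> norm (T x)" for x
  proof (cases "x = 0")
    case False
    have "a * norm x * norm x \<le> norm (T x) * norm x"
      using order_trans[OF a(2) reK_vinner_le] by (simp add: power2_eq_square mult.assoc)
    then show ?thesis using False by simp
  qed (use a in simp)
  have inj: "x = y" if "T x = T y" for x y
  proof -
    have "T (x - y) = T x - T y" using lin(1)[of "x - y" y] by simp
    then show ?thesis using low[of "x - y"] a that by (simp add: mult_le_0_iff)
  qed
  have "\<exists>x. T x = y" for y
  proof -
    have "\<exists>z. \<forall>x. vinner H x y = vinner H x (T z)"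
    proof (rule coercive_representation[of T C a _ "norm y"])
      show "norm (vinner H x y) \<le> norm y * norm x" for x
        using norm_vinner_le[of x y] by (simp add: mult.commute)
    qed (use lin a selfadjointD[OF T] in \<open>auto simp: vinner_add vinner_scale\<close>)
    then show ?thesis using vinner_eqI by metis
  qed
  then obtain T' where T': "\<And>y. T (T' y) = y" by metis
  \<comment> \<open>The constant 1 / a is \<open>low\<close> read backwards; each linearity law for
    \<open>T'\<close> is checked after applying the injective \<open>T\<close> to both
    sides.\<close>
  have "T' \<in> bounded_ops H H" unfolding bounded_ops_iff
  proof (intro conjI allI exI)
    show "norm (T' x) \<le> (1 / a) * norm x" for x
      using low[of "T' x"] a by (simp add: T' field_simps)
  qed (rule inj, simp add: T' lin)+
  moreover have "T' (T x) = x" for x by (rule inj) (rule T')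
  ultimately show ?thesis unfolding invertible_op_def using Tb T' by blast
qed

end

section \<open>Square-integrable functions\<close>

lemma strongly_measurable_continuous:
  assumes "strongly_measurable M f" "continuous_on UNIV h"
  shows "strongly_measurable M (\<lambda>\<alpha>. h (f \<alpha>))"
proof -
  obtain s where s: "\<And>n::nat. simple_function M (s n)"
      "\<And>\<alpha>. \<alpha> \<in> space M \<Longrightarrow> (\<lambda>n. s n \<alpha>) \<longlonglongrightarrow> f \<alpha>"
    using assms(1) unfolding strongly_measurable_def by blast
  show ?thesis unfolding strongly_measurable_def
  proof (intro exI[of _ "\<lambda>n \<alpha>. h (s n \<alpha>)"] conjI allI ballI)
    show "simple_function M (\<lambda>\<alpha>. h (s n \<alpha>))" for n
      by (rule simple_function_compose1[OF s(1)])
    show "(\<lambda>n. h (s n \<alpha>)) \<longlonglongrightarrow> h (f \<alpha>)" if "\<alpha> \<in> space M" for \<alpha>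
      by (rule continuous_on_tendsto_compose[OF assms(2) s(2)[OF that]]) auto
  qed
qed

text \<open>Pairs of simple functions are simple, whatever the size of the spaces; this is the step
  that can fail for Borel measurability without separability. Sums and inner products then follow by
  continuity.\<close>

lemma strongly_measurable_Pair:
  assumes "strongly_measurable M f" "strongly_measurable M g"
  shows "strongly_measurable M (\<lambda>\<alpha>. (f \<alpha>, g \<alpha>))"
proof -
  obtain s where s: "\<And>n::nat. simple_function M (s n)"
      "\<And>\<alpha>. \<alpha> \<in> space M \<Longrightarrow> (\<lambda>n. s n \<alpha>) \<longlonglongrightarrow> f \<alpha>"
    using assms(1) unfolding strongly_measurable_def by blast
  obtain t where t: "\<And>n::nat. simple_function M (t n)"
      "\<And>\<alpha>. \<alpha> \<in> space M \<Longrightarrow> (\<lambda>n. t n \<alpha>) \<longlonglongrightarrow> g \<alpha>"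
    using assms(2) unfolding strongly_measurable_def by blast
  show ?thesis unfolding strongly_measurable_def
    by (intro exI[of _ "\<lambda>n \<alpha>. (s n \<alpha>, t n \<alpha>)"] conjI allI ballI simple_function_Pair
        tendsto_Pair s t)
qed

lemma strongly_measurable_continuous2:
  assumes "strongly_measurable M f" "strongly_measurable M g"
    and "continuous_on UNIV (\<lambda>p. h (fst p) (snd p))"
  shows "strongly_measurable M (\<lambda>\<alpha>. h (f \<alpha>) (g \<alpha>))"
  using strongly_measurable_continuous[OF strongly_measurable_Pair[OF assms(1,2)] assms(3)] by simp

lemma strongly_measurable_indicator:
  assumes "D \<in> sets M"
  shows "strongly_measurable M (indicator D :: _ \<Rightarrow> real)"
  unfolding strongly_measurable_def
  by (intro exI[of _ "\<lambda>_. indicator D"]) (use assms in auto)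

lemma strongly_measurable_borel:
  fixes f :: "'a \<Rightarrow> 'b::metric_space"
  assumes "strongly_measurable M f" shows "f \<in> borel_measurable M"
proof -
  obtain s where s: "\<And>n::nat. simple_function M (s n)"
      "\<And>\<alpha>. \<alpha> \<in> space M \<Longrightarrow> (\<lambda>n. s n \<alpha>) \<longlonglongrightarrow> f \<alpha>"
    using assms unfolding strongly_measurable_def by blast
  show ?thesis
    by (rule borel_measurable_LIMSEQ_metric[OF borel_measurable_simple_function[OF s(1)] s(2)])
qed

lemma norm_borel:
  fixes f :: "'a \<Rightarrow> 'b::real_normed_vector"
  assumes "strongly_measurable M f" shows "(\<lambda>\<alpha>. norm (f \<alpha>)) \<in> borel_measurable M"
  using strongly_measurable_borel[OF assms] by measurable

lemma square_integrableI:
  assumes "strongly_measurable M f" "integrable M u" "\<And>\<alpha>. \<alpha> \<in> space M \<Longrightarrow> (norm (f \<alpha>))\<^sup>2 \<le> u \<alpha>"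
  shows "f \<in> square_integrable M"
proof -
  have "integrable M (\<lambda>\<alpha>. (norm (f \<alpha>))\<^sup>2)"
    by (rule Bochner_Integration.integrable_bound[OF assms(2)])
      (use norm_borel[OF assms(1)] assms(3) in \<open>auto intro!: AE_I2 order_trans[OF _ abs_ge_self]\<close>)
  then show ?thesis using assms(1) by (simp add: square_integrable_def)
qed

lemma square_integrable_add:
  assumes "f \<in> square_integrable M" "g \<in> square_integrable M"
  shows "(\<lambda>\<alpha>. f \<alpha> + g \<alpha>) \<in> square_integrable M"
proof (rule square_integrableI)
  show "strongly_measurable M (\<lambda>\<alpha>. f \<alpha> + g \<alpha>)"
    by (rule strongly_measurable_continuous2)
      (use assms in \<open>auto simp: square_integrable_def intro!: continuous_intros\<close>)
  show "integrable M (\<lambda>\<alpha>. 2 * (norm (f \<alpha>))\<^sup>2 + 2 * (norm (g \<alpha>))\<^sup>2)"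
    using assms by (simp add: square_integrable_def)
  show "(norm (f \<alpha> + g \<alpha>))\<^sup>2 \<le> 2 * (norm (f \<alpha>))\<^sup>2 + 2 * (norm (g \<alpha>))\<^sup>2" for \<alpha>
  proof -
    have "(norm (f \<alpha> + g \<alpha>))\<^sup>2 \<le> (norm (f \<alpha>) + norm (g \<alpha>))\<^sup>2"
      by (simp add: norm_triangle_ineq power_mono)
    also have "\<dots> \<le> 2 * (norm (f \<alpha>))\<^sup>2 + 2 * (norm (g \<alpha>))\<^sup>2"
      using zero_le_power2[of "norm (f \<alpha>) - norm (g \<alpha>)"] by (simp add: power2_eq_square algebra_simps)
    finally show ?thesis .
  qed
qed

text \<open>The discriminant argument behind Cauchy--Schwarz: evaluate at the vertex t = P / F, and
  treat the degenerate case F = 0 apart.\<close>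

lemma nonneg_quadratic_imp:
  fixes F G P :: real
  assumes "\<And>t. 0 \<le> F * t\<^sup>2 - 2 * P * t + G" "0 \<le> F"
  shows "P\<^sup>2 \<le> F * G"
proof (cases "F = 0")
  case True
  \<comment> \<open>For F = 0 the expression is affine in t; if P were nonzero, this t would give it
    the value -1.\<close>
  then have "P = 0" using assms(1)[of "(G + 1) / (2 * P)"] by (cases "P = 0") auto
  then show ?thesis using True by simp
next
  case False
  have "0 \<le> F * (F * (P / F)\<^sup>2 - 2 * P * (P / F) + G)"
    by (intro mult_nonneg_nonneg assms)
  also have "\<dots> = F * G - P\<^sup>2" using False by (simp add: field_simps power2_eq_square)
  finally show ?thesis by simp
qed

section \<open>Classes modulo equality almost everywhere and their inner product\<close>

lemma mem_L2_class:
  "g \<in> L2_class M f \<longleftrightarrow> f \<in> square_integrable M \<and> g \<in> square_integrable M \<and> (AE \<alpha> in M. f \<alpha> = g \<alpha>)"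
  by (auto simp: L2_class_def ae_rel_def)

lemma L2_class_eqI:
  assumes "f \<in> square_integrable M" "g \<in> square_integrable M" "AE \<alpha> in M. f \<alpha> = g \<alpha>"
  shows "L2_class M f = L2_class M g"
proof -
  have "h \<in> L2_class M f \<longleftrightarrow> h \<in> L2_class M g" for h
    unfolding mem_L2_class using assms by (auto elim: eventually_elim2)
  then show ?thesis by blast
qed

lemma L2_class_self: "f \<in> square_integrable M \<Longrightarrow> f \<in> L2_class M f"
  by (simp add: mem_L2_class)

lemma vecs_L2_iff: "F \<in> vecs (L2_space M H) \<longleftrightarrow> (\<exists>f\<in>square_integrable M. F = L2_class M f)"
  by (auto simp: L2_space_def quotient_def L2_class_def)

lemma L2_class_in_vecs: "f \<in> square_integrable M \<Longrightarrow> L2_class M f \<in> vecs (L2_space M H)"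
  using vecs_L2_iff by metis

lemma ball_vecs_L2:
  "(\<forall>F\<in>vecs (L2_space M H). P F) \<longleftrightarrow> (\<forall>f\<in>square_integrable M. P (L2_class M f))"
  using vecs_L2_iff L2_class_in_vecs by metis

context hilbert_space begin

lemma bounded_linear_vscale: "bounded_linear (vscale H c)"
proof -
  interpret V: vector_space "vscale H" by (rule vector_space)
  show ?thesis
    by (rule bounded_linear_intro[of _ "norm c"])
      (simp_all add: V.scale_right_distrib norm_vscale mult.commute flip: vscale_of_real)
qed

lemma square_integrable_vscale:
  assumes "f \<in> square_integrable M"
  shows "(\<lambda>\<alpha>. vscale H c (f \<alpha>)) \<in> square_integrable M"
proof (rule square_integrableI)
  show "strongly_measurable M (\<lambda>\<alpha>. vscale H c (f \<alpha>))"
    by (rule strongly_measurable_continuous[OF _ linear_continuous_on[OF bounded_linear_vscale]])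
      (use assms in \<open>simp add: square_integrable_def\<close>)
  show "integrable M (\<lambda>\<alpha>. (norm c)\<^sup>2 * (norm (f \<alpha>))\<^sup>2)"
    using assms by (simp add: square_integrable_def)
qed (simp add: norm_vscale power_mult_distrib)

lemma vinner_borel:
  assumes "strongly_measurable M f" "strongly_measurable M g"
  shows "(\<lambda>\<alpha>. vinner H (f \<alpha>) (g \<alpha>)) \<in> borel_measurable M"
  by (rule strongly_measurable_borel[OF strongly_measurable_continuous2[OF assms]])
    (intro vinner.continuous_on continuous_intros)

lemma integrable_vinner:
  assumes "f \<in> square_integrable M" "g \<in> square_integrable M"
  shows "integrable M (\<lambda>\<alpha>. vinner H (f \<alpha>) (g \<alpha>))"
proof (rule Bochner_Integration.integrable_bound)
  show "integrable M (\<lambda>\<alpha>. (norm (f \<alpha>))\<^sup>2 + (norm (g \<alpha>))\<^sup>2)"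
    using assms by (simp add: square_integrable_def)
  show "(\<lambda>\<alpha>. vinner H (f \<alpha>) (g \<alpha>)) \<in> borel_measurable M"
    using assms by (intro vinner_borel) (simp_all add: square_integrable_def)
  have "norm (vinner H x y) \<le> norm ((norm x)\<^sup>2 + (norm y)\<^sup>2)" for x y
  proof -
    have "norm x * norm y \<le> (norm x)\<^sup>2 + (norm y)\<^sup>2"
      using zero_le_power2[of "norm x - norm y"] mult_nonneg_nonneg[OF norm_ge_zero norm_ge_zero, of x y]
      unfolding power2_diff by linarith
    then show ?thesis using norm_vinner_le[of x y] by simp
  qed
  then show "AE \<alpha> in M. norm (vinner H (f \<alpha>) (g \<alpha>)) \<le> norm ((norm (f \<alpha>))\<^sup>2 + (norm (g \<alpha>))\<^sup>2)"
    by simp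
qed

lemma integral_vinner_self:
  assumes "f \<in> square_integrable M"
  shows "(LINT \<alpha>|M. vinner H (f \<alpha>) (f \<alpha>)) = of_real (LINT \<alpha>|M. (norm (f \<alpha>))\<^sup>2)"
  unfolding vinner_self
  by (rule integral_bounded_linear[OF bounded_linear_of_real])
    (use assms in \<open>simp add: square_integrable_def\<close>)

text \<open>The pointwise Cauchy--Schwarz inequality reduces the claim to the real functions
  \<open>norm (f \<alpha>)\<close> and \<open>norm (g \<alpha>)\<close>; the nonnegative quadratic
  in t is the integral of the square of
  \<open>t * norm (f \<alpha>) - norm (g \<alpha>)\<close>.\<close>

lemma norm_integral_vinner_le:
  assumes f: "f \<in> square_integrable M" and g: "g \<in> square_integrable M"
  shows "norm (LINT \<alpha>|M. vinner H (f \<alpha>) (g \<alpha>))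
    \<le> sqrt (LINT \<alpha>|M. (norm (f \<alpha>))\<^sup>2) * sqrt (LINT \<alpha>|M. (norm (g \<alpha>))\<^sup>2)"
proof -
  let ?P = "LINT \<alpha>|M. norm (f \<alpha>) * norm (g \<alpha>)"
  have fi: "integrable M (\<lambda>\<alpha>. (norm (f \<alpha>))\<^sup>2)" and gi: "integrable M (\<lambda>\<alpha>. (norm (g \<alpha>))\<^sup>2)"
    and fm: "strongly_measurable M f" and gm: "strongly_measurable M g"
    using f g by (auto simp: square_integrable_def)
  have fgi: "integrable M (\<lambda>\<alpha>. norm (f \<alpha>) * norm (g \<alpha>))"
  proof (rule Bochner_Integration.integrable_bound[OF Bochner_Integration.integrable_add[OF fi gi]])
    show "(\<lambda>\<alpha>. norm (f \<alpha>) * norm (g \<alpha>)) \<in> borel_measurable M"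
      using norm_borel[OF fm] norm_borel[OF gm] by measurable
    have "x * y \<le> x\<^sup>2 + y\<^sup>2" if "0 \<le> x" "0 \<le> y" for x y :: real
      using zero_le_power2[of "x - y"] mult_nonneg_nonneg[OF that] unfolding power2_diff by simp
    then show "AE \<alpha> in M. norm (norm (f \<alpha>) * norm (g \<alpha>)) \<le> norm ((norm (f \<alpha>))\<^sup>2 + (norm (g \<alpha>))\<^sup>2)"
      by simp
  qed
  have "?P\<^sup>2 \<le> (LINT \<alpha>|M. (norm (f \<alpha>))\<^sup>2) * (LINT \<alpha>|M. (norm (g \<alpha>))\<^sup>2)"
  proof (rule nonneg_quadratic_imp)
    fix t
    have "0 \<le> (LINT \<alpha>|M. (t * norm (f \<alpha>) - norm (g \<alpha>))\<^sup>2)" by simp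
    also have "\<dots> = (LINT \<alpha>|M. t\<^sup>2 * (norm (f \<alpha>))\<^sup>2 - 2 * t * (norm (f \<alpha>) * norm (g \<alpha>)) + (norm (g \<alpha>))\<^sup>2)"
      by (simp add: power2_diff power_mult_distrib algebra_simps)
    also have "\<dots> = (LINT \<alpha>|M. (norm (f \<alpha>))\<^sup>2) * t\<^sup>2 - 2 * ?P * t + (LINT \<alpha>|M. (norm (g \<alpha>))\<^sup>2)"
      using fi gi fgi by (simp add: algebra_simps)
    finally show "0 \<le> (LINT \<alpha>|M. (norm (f \<alpha>))\<^sup>2) * t\<^sup>2 - 2 * ?P * t + (LINT \<alpha>|M. (norm (g \<alpha>))\<^sup>2)" .
  qed simp
  then have P: "?P \<le> sqrt (LINT \<alpha>|M. (norm (f \<alpha>))\<^sup>2) * sqrt (LINT \<alpha>|M. (norm (g \<alpha>))\<^sup>2)"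
    unfolding real_sqrt_mult[symmetric] by (rule real_le_rsqrt)
  have "norm (LINT \<alpha>|M. vinner H (f \<alpha>) (g \<alpha>)) \<le> (LINT \<alpha>|M. norm (vinner H (f \<alpha>) (g \<alpha>)))"
    by (rule integral_norm_bound)
  also have "\<dots> \<le> ?P"
    by (intro integral_mono integrable_norm integrable_vinner f g fgi norm_vinner_le)
  finally show ?thesis using P by linarith
qed

text \<open>\<open>vadd\<close> is a union over all pairs of representatives. All these pairs give
  the same class, so it is the union of a constant family over nonempty index sets.\<close>

lemma vadd_L2:
  assumes "f \<in> square_integrable M" "g \<in> square_integrable M"
  shows "vadd (L2_space M H) (L2_class M f) (L2_class M g) = L2_class M (\<lambda>\<alpha>. f \<alpha> + g \<alpha>)"
proof -
  have "L2_class M (\<lambda>\<alpha>. f' \<alpha> + g' \<alpha>) = L2_class M (\<lambda>\<alpha>. f \<alpha> + g \<alpha>)"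
    if "f' \<in> L2_class M f" "g' \<in> L2_class M g" for f' g'
  proof (rule L2_class_eqI)
    have "AE \<alpha> in M. f \<alpha> = f' \<alpha>" "AE \<alpha> in M. g \<alpha> = g' \<alpha>"
      using that by (simp_all add: mem_L2_class)
    then show "AE \<alpha> in M. f' \<alpha> + g' \<alpha> = f \<alpha> + g \<alpha>" by eventually_elim simp
  qed (use that in \<open>auto simp: mem_L2_class intro!: square_integrable_add\<close>)
  then have "(\<Union>f'\<in>L2_class M f. \<Union>g'\<in>L2_class M g. L2_class M (\<lambda>\<alpha>. f' \<alpha> + g' \<alpha>))
      = (\<Union>f'\<in>L2_class M f. \<Union>g'\<in>L2_class M g. L2_class M (\<lambda>\<alpha>. f \<alpha> + g \<alpha>))"
    by (intro SUP_cong refl)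
  also have "\<dots> = L2_class M (\<lambda>\<alpha>. f \<alpha> + g \<alpha>)"
    using L2_class_self[OF assms(1)] L2_class_self[OF assms(2)] by blast
  finally show ?thesis by (simp add: L2_space_def)
qed

lemma vscale_L2:
  assumes "f \<in> square_integrable M"
  shows "vscale (L2_space M H) c (L2_class M f) = L2_class M (\<lambda>\<alpha>. vscale H c (f \<alpha>))"
proof -
  have "L2_class M (\<lambda>\<alpha>. vscale H c (f' \<alpha>)) = L2_class M (\<lambda>\<alpha>. vscale H c (f \<alpha>))"
    if "f' \<in> L2_class M f" for f'
  proof (rule L2_class_eqI)
    show "AE \<alpha> in M. vscale H c (f' \<alpha>) = vscale H c (f \<alpha>)"
      using that unfolding mem_L2_class by (auto elim: eventually_mono)
  qed (use that in \<open>auto simp: mem_L2_class intro!: square_integrable_vscale\<close>)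
  then have "(\<Union>f'\<in>L2_class M f. L2_class M (\<lambda>\<alpha>. vscale H c (f' \<alpha>)))
      = (\<Union>f'\<in>L2_class M f. L2_class M (\<lambda>\<alpha>. vscale H c (f \<alpha>)))"
    by (intro SUP_cong refl)
  also have "\<dots> = L2_class M (\<lambda>\<alpha>. vscale H c (f \<alpha>))"
    using L2_class_self[OF assms(1)] by blast
  finally show ?thesis by (simp add: L2_space_def)
qed

lemma vinner_L2:
  assumes "f \<in> square_integrable M" "g \<in> square_integrable M"
  shows "vinner (L2_space M H) (L2_class M f) (L2_class M g) = (LINT \<alpha>|M. vinner H (f \<alpha>) (g \<alpha>))"
proof -
  have eq: "(LINT \<alpha>|M. vinner H (f' \<alpha>) (g' \<alpha>)) = (LINT \<alpha>|M. vinner H (f \<alpha>) (g \<alpha>))"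
    if "f' \<in> L2_class M f" "g' \<in> L2_class M g" for f' g'
  proof (rule integral_cong_AE)
    have "AE \<alpha> in M. f \<alpha> = f' \<alpha>" "AE \<alpha> in M. g \<alpha> = g' \<alpha>"
      using that by (simp_all add: mem_L2_class)
    then show "AE \<alpha> in M. vinner H (f' \<alpha>) (g' \<alpha>) = vinner H (f \<alpha>) (g \<alpha>)"
      by eventually_elim simp
  qed (use that in \<open>auto simp: mem_L2_class intro!: borel_measurable_integrable integrable_vinner\<close>)
  show ?thesis unfolding L2_space_def ip_space.simps
  proof (rule the_equality)
    show "\<forall>f'\<in>L2_class M f. \<forall>g'\<in>L2_class M g.
        (LINT \<alpha>|M. vinner H (f \<alpha>) (g \<alpha>)) = (LINT \<alpha>|M. vinner H (f' \<alpha>) (g' \<alpha>))"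
      using eq by simp
  qed (use assms L2_class_self in blast)
qed

lemma vnorm_L2:
  assumes "f \<in> square_integrable M"
  shows "vnorm (L2_space M H) (L2_class M f) = sqrt (LINT \<alpha>|M. (norm (f \<alpha>))\<^sup>2)"
  using assms by (simp add: vnorm_def vinner_L2 integral_vinner_self)

end

section \<open>Square-integrability by duality over a semifinite measure\<close>

text \<open>Exhaustion: the supremum \<open>s\<close> of the measures of finite-measure subsets of
  \<open>E\<close> is attained by a countable union, itself of measure at most \<open>K\<close>. If
  \<open>E\<close> were infinite, so would be the remainder, and a piece of positive finite measure
  found there would push the measure beyond \<open>s\<close>.\<close>

lemma semifinite_emeasure_finite:
  assumes "semifinite M" and E: "E \<in> sets M" and K: "K < \<infinity>"
    and bound: "\<And>D. D \<in> sets M \<Longrightarrow> D \<subseteq> E \<Longrightarrow> emeasure M D < \<infinity> \<Longrightarrow> emeasure M D \<le> K"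
  shows "emeasure M E < \<infinity>"
proof (rule ccontr)
  assume "\<not> emeasure M E < \<infinity>"
  then have inf: "emeasure M E = \<infinity>" by (simp flip: less_top)
  define \<D> where "\<D> = {D \<in> sets M. D \<subseteq> E \<and> emeasure M D < \<infinity>}"
  define s where "s = (SUP D\<in>\<D>. emeasure M D)"
  have "\<D> \<noteq> {}" by (auto simp: \<D>_def intro!: exI[of _ "{}"])
  then obtain f :: "nat \<Rightarrow> ennreal" where f: "range f \<subseteq> emeasure M ` \<D>" "s = (SUP i. f i)"
    using ennreal_Sup_countable_SUP[of "emeasure M ` \<D>"] unfolding s_def by auto
  have "\<forall>i. \<exists>D\<in>\<D>. f i = emeasure M D" using f(1) by blast
  then obtain D where D: "\<And>i::nat. D i \<in> \<D>" "\<And>i. f i = emeasure M (D i)" by metis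
  \<comment> \<open>Finite unions make the maximizing sequence increasing without leaving
    \<open>\<D>\<close>, so the bound \<open>K\<close> passes to the limit by continuity from
    below.\<close>
  define C where "C n = (\<Union>i\<le>n. D i)" for n
  have C: "C n \<in> \<D>" for n
  proof (induction n)
    case (Suc n)
    have "C (Suc n) = C n \<union> D (Suc n)" by (auto simp: C_def atMost_Suc)
    moreover have "emeasure M (C n \<union> D (Suc n)) \<le> emeasure M (C n) + emeasure M (D (Suc n))"
      using Suc D by (intro emeasure_subadditive) (auto simp: \<D>_def)
    moreover have "emeasure M (C n) + emeasure M (D (Suc n)) < \<infinity>"
      using Suc D(1)[of "Suc n"] by (simp add: \<D>_def)
    ultimately have "emeasure M (C (Suc n)) < \<infinity>" by (simp only: le_less_trans)
    then show ?case using Suc D(1)[of "Suc n"] by (auto simp: \<D>_def \<open>C (Suc n) = C n \<union> D (Suc n)\<close>)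
  qed (use D in \<open>simp add: C_def\<close>)
  let ?U = "\<Union>n. C n"
  have U: "emeasure M ?U = (SUP n. emeasure M (C n))"
    using C by (intro SUP_emeasure_incseq[symmetric])
      (auto simp: \<D>_def incseq_def C_def dest: order_trans)
  have Us: "?U \<in> sets M" "?U \<subseteq> E" using C by (auto simp: \<D>_def)
  have UK: "emeasure M ?U \<le> K" unfolding U
    using C bound by (intro SUP_least) (auto simp: \<D>_def)
  then have Ufin: "emeasure M ?U < \<infinity>" using K by (rule le_less_trans)
  have sU: "s \<le> emeasure M ?U" unfolding f(2) D(2)
    by (intro SUP_least emeasure_mono Us) (auto simp: C_def)
  have "emeasure M E \<le> emeasure M (E - ?U) + emeasure M ?U"
    using emeasure_subadditive[of "E - ?U" M ?U] Us E by (simp add: Un_absorb2)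
  then have "emeasure M (E - ?U) = \<infinity>" using inf Ufin by (auto simp: top_unique)
  then obtain D' where D': "D' \<in> sets M" "D' \<subseteq> E - ?U" "0 < emeasure M D'" "emeasure M D' < \<infinity>"
    using assms(1)[unfolded semifinite_def, rule_format, OF sets.Diff[OF E Us(1)]] by blast
  have eq: "emeasure M (?U \<union> D') = emeasure M ?U + emeasure M D'"
    by (rule plus_emeasure[symmetric, OF Us(1) D'(1)]) (use D'(2) in blast)
  have "?U \<union> D' \<in> \<D>" unfolding \<D>_def mem_Collect_eq eq
  proof (intro conjI)
    show "?U \<union> D' \<in> sets M" by (rule sets.Un[OF Us(1) D'(1)])
    show "?U \<union> D' \<subseteq> E" using D'(2) Us(2) by (intro Un_least) auto
    show "emeasure M ?U + emeasure M D' < \<infinity>" using Ufin D'(4) by simp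
  qed
  then have "emeasure M (?U \<union> D') \<le> s" unfolding s_def by (rule SUP_upper)
  then have "emeasure M ?U + emeasure M D' \<le> emeasure M ?U + 0"
    unfolding eq add_0_right using sU by (rule order_trans)
  then show False using D'(3) Ufin
    by (simp only: ennreal_add_left_cancel_le) auto
qed

text \<open>Testing against \<open>g\<close> truncated to \<open>{1/n \<le> \<parallel>g\<parallel> \<le> n}\<close>; semifiniteness makes its measure finite.\<close>

lemma (in hilbert_space) square_integrable_if_bounded_functional:
  assumes sf: "semifinite M" and g: "strongly_measurable M g"
    and K: "\<And>f. f \<in> square_integrable M \<Longrightarrow>
      norm (LINT \<alpha>|M. vinner H (f \<alpha>) (g \<alpha>)) \<le> K * sqrt (LINT \<alpha>|M. (norm (f \<alpha>))\<^sup>2)"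
  shows "g \<in> square_integrable M"
proof -
  have gb[measurable]: "(\<lambda>\<alpha>. norm (g \<alpha>)) \<in> borel_measurable M" by (rule norm_borel[OF g])
  \<comment> \<open>For g cut off to \<open>D\<close> the integral of <f, g> is q = |f|^2, so the
    hypothesis reads q \<le> K sqrt q. Hence q \<le> K^2, independently of \<open>D\<close> and
    \<open>c\<close>; q = 0 is separated because \<open>sqrt q\<close> is cancelled.\<close>
  have trunc: "integrable M (\<lambda>\<alpha>. indicator D \<alpha> * (norm (g \<alpha>))\<^sup>2)
      \<and> (LINT \<alpha>|M. indicator D \<alpha> * (norm (g \<alpha>))\<^sup>2) \<le> K\<^sup>2"
    if D: "D \<in> sets M" "emeasure M D < \<infinity>" "\<And>\<alpha>. \<alpha> \<in> D \<Longrightarrow> norm (g \<alpha>) \<le> c" for D c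
  proof -
    define f where "f = (\<lambda>\<alpha>. indicator D \<alpha> *\<^sub>R g \<alpha>)"
    have ff: "(norm (f \<alpha>))\<^sup>2 = indicator D \<alpha> * (norm (g \<alpha>))\<^sup>2" for \<alpha>
      by (simp add: f_def indicator_def)
    have f: "f \<in> square_integrable M"
    proof (rule square_integrableI)
      show "strongly_measurable M f" unfolding f_def
        by (rule strongly_measurable_continuous2[OF strongly_measurable_indicator[OF D(1)] g])
          (intro continuous_intros)
      show "integrable M (\<lambda>\<alpha>. c\<^sup>2 * indicator D \<alpha>)" using D by simp
      show "(norm (f \<alpha>))\<^sup>2 \<le> c\<^sup>2 * indicator D \<alpha>" for \<alpha>
        unfolding ff using D(3) by (auto simp: indicator_def intro: power_mono)
    qed
    define q where "q = (LINT \<alpha>|M. (norm (f \<alpha>))\<^sup>2)"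
    have q0: "0 \<le> q" by (simp add: q_def)
    have "vinner H (f \<alpha>) (g \<alpha>) = vinner H (f \<alpha>) (f \<alpha>)" for \<alpha>
      by (simp add: f_def indicator_def vinner.zero_left)
    then have "(LINT \<alpha>|M. vinner H (f \<alpha>) (g \<alpha>)) = of_real q"
      by (simp add: integral_vinner_self[OF f] q_def)
    then have "q \<le> K * sqrt q" using K[OF f] q0 by (simp add: q_def[symmetric])
    then have "sqrt q * sqrt q \<le> K * sqrt q" using q0 by simp
    then have "sqrt q \<le> K \<or> q = 0" using q0
      by (metis mult_right_le_imp_le order_le_imp_less_or_eq real_sqrt_eq_zero_cancel real_sqrt_ge_zero)
    then have "q \<le> K\<^sup>2" using q0 by (auto intro: sqrt_le_D)
    then show ?thesis using f unfolding q_def square_integrable_def mem_Collect_eq ff by blast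
  qed
  \<comment> \<open>The upper cutoff makes the truncation square-integrable on sets of finite
    measure, the lower one controls the measure. \<open>Suc n\<close> keeps the lower cutoff
    positive: at n = 0 the term 1 / 0 would be 0.\<close>
  define E where "E n = {\<alpha>\<in>space M. 1 / real (Suc n) \<le> norm (g \<alpha>) \<and> norm (g \<alpha>) \<le> real (Suc n)}" for n
  have E[measurable]: "E n \<in> sets M" for n unfolding E_def by measurable
  have fin: "emeasure M (E n) < \<infinity>" for n
  \<comment> \<open>Chebyshev: on a finite-measure subset of \<open>E n\<close> the function |g|^2
    is at least 1 / (n + 1)^2, and its integral there is at most K^2.\<close>
  proof (rule semifinite_emeasure_finite[OF sf E, of "ennreal (K\<^sup>2 * (real (Suc n))\<^sup>2)"])
    fix D assume D: "D \<in> sets M" "D \<subseteq> E n" "emeasure M D < \<infinity>"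
    have *: "integrable M (\<lambda>\<alpha>. indicator D \<alpha> * (norm (g \<alpha>))\<^sup>2)"
        "(LINT \<alpha>|M. indicator D \<alpha> * (norm (g \<alpha>))\<^sup>2) \<le> K\<^sup>2"
      using trunc[OF D(1,3), of "real (Suc n)"] D(2) by (auto simp: E_def)
    have "measure M D * (1 / real (Suc n))\<^sup>2 = (LINT \<alpha>|M. indicator D \<alpha> * (1 / real (Suc n))\<^sup>2)"
      using D by simp
    also have "\<dots> \<le> (LINT \<alpha>|M. indicator D \<alpha> * (norm (g \<alpha>))\<^sup>2)"
    proof (rule integral_mono[OF _ *(1)])
      show "integrable M (\<lambda>\<alpha>. indicator D \<alpha> * (1 / real (Suc n))\<^sup>2)" using D by simp
      show "indicator D \<alpha> * (1 / real (Suc n))\<^sup>2 \<le> indicator D \<alpha> * (norm (g \<alpha>))\<^sup>2" for \<alpha>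
        using D(2) by (auto simp: indicator_def E_def intro!: power_mono simp del: of_nat_Suc power_divide)
    qed
    finally have "measure M D * (1 / real (Suc n))\<^sup>2 \<le> K\<^sup>2" using *(2) by linarith
    then have "measure M D \<le> K\<^sup>2 * (real (Suc n))\<^sup>2"
      by (simp add: power_divide divide_le_eq del: of_nat_Suc)
    then show "emeasure M D \<le> ennreal (K\<^sup>2 * (real (Suc n))\<^sup>2)"
      using D by (simp add: emeasure_eq_ennreal_measure less_top ennreal_leI)
  qed simp
  \<comment> \<open>Monotone convergence is applied with pointwise limits on the whole type; the
    factor \<open>indicator (space M)\<close> makes the limit correct outside the space too.\<close>
  have lim: "(\<lambda>n. \<integral>\<^sup>+\<alpha>. ennreal (indicator (E n) \<alpha> * (norm (g \<alpha>))\<^sup>2) \<partial>M)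
      \<longlonglongrightarrow> (\<integral>\<^sup>+\<alpha>. ennreal (indicator (space M) \<alpha> * (norm (g \<alpha>))\<^sup>2) \<partial>M)"
  proof (rule nn_integral_LIMSEQ)
    have "E m \<subseteq> E n" if "m \<le> n" for m n
    proof -
      have "1 / real (Suc n) \<le> 1 / real (Suc m)" "real (Suc m) \<le> real (Suc n)"
        using that by (simp_all add: field_simps)
      then show ?thesis unfolding E_def by (auto simp del: of_nat_Suc dest: order_trans[of "1 / real (Suc n)"]
          order_trans[of _ "real (Suc m)"])
    qed
    then show "incseq (\<lambda>n \<alpha>. ennreal (indicator (E n) \<alpha> * (norm (g \<alpha>))\<^sup>2))"
      by (auto simp: incseq_def le_fun_def indicator_def intro!: ennreal_leI)
    show "(\<lambda>\<alpha>. ennreal (indicator (E n) \<alpha> * (norm (g \<alpha>))\<^sup>2)) \<in> borel_measurable M" for n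
      by measurable
  next
    fix \<alpha>
    show "(\<lambda>n. ennreal (indicator (E n) \<alpha> * (norm (g \<alpha>))\<^sup>2))
        \<longlonglongrightarrow> ennreal (indicator (space M) \<alpha> * (norm (g \<alpha>))\<^sup>2)"
    \<comment> \<open>A zero of \<open>g\<close> lies in no \<open>E n\<close>, but both sides
      vanish there; any other point of the space is eventually in \<open>E n\<close>.\<close>
    proof (cases "g \<alpha> = 0 \<or> \<alpha> \<notin> space M")
      case True
      then have "indicator (E n) \<alpha> * (norm (g \<alpha>))\<^sup>2 = indicator (space M) \<alpha> * (norm (g \<alpha>))\<^sup>2" for n
        by (auto simp: E_def)
      then show ?thesis by (simp only: tendsto_const)
    next
      case False
      have "eventually (\<lambda>n. 1 / real (Suc n) < norm (g \<alpha>)) sequentially"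
        by (rule order_tendstoD(2)[OF LIMSEQ_Suc[OF lim_1_over_n]]) (use False in simp)
      moreover have "eventually (\<lambda>n. norm (g \<alpha>) \<le> real n) sequentially"
        using filterlim_real_sequentially unfolding filterlim_at_top by blast
      ultimately have "eventually (\<lambda>n. ennreal (indicator (space M) \<alpha> * (norm (g \<alpha>))\<^sup>2)
          = ennreal (indicator (E n) \<alpha> * (norm (g \<alpha>))\<^sup>2)) sequentially"
        by eventually_elim (use False in \<open>auto simp: E_def indicator_def\<close>)
      then show ?thesis by (rule Lim_transform_eventually[OF tendsto_const])
    qed
  qed
  have "(\<integral>\<^sup>+\<alpha>. ennreal (indicator (E n) \<alpha> * (norm (g \<alpha>))\<^sup>2) \<partial>M) \<le> ennreal (K\<^sup>2)" for n
  proof -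
    have "integrable M (\<lambda>\<alpha>. indicator (E n) \<alpha> * (norm (g \<alpha>))\<^sup>2)
        \<and> (LINT \<alpha>|M. indicator (E n) \<alpha> * (norm (g \<alpha>))\<^sup>2) \<le> K\<^sup>2"
      by (rule trunc[OF E fin]) (auto simp: E_def)
    then show ?thesis by (simp add: nn_integral_eq_integral ennreal_leI)
  qed
  then have "(\<integral>\<^sup>+\<alpha>. ennreal (indicator (space M) \<alpha> * (norm (g \<alpha>))\<^sup>2) \<partial>M) \<le> ennreal (K\<^sup>2)"
    by (intro LIMSEQ_le_const2[OF lim]) auto
  moreover have "(\<integral>\<^sup>+\<alpha>. ennreal (indicator (space M) \<alpha> * (norm (g \<alpha>))\<^sup>2) \<partial>M)
      = (\<integral>\<^sup>+\<alpha>. ennreal ((norm (g \<alpha>))\<^sup>2) \<partial>M)"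
    by (intro nn_integral_cong) simp
  ultimately have "(\<integral>\<^sup>+\<alpha>. ennreal ((norm (g \<alpha>))\<^sup>2) \<partial>M) \<le> ennreal (K\<^sup>2)" by simp
  then have "integrable M (\<lambda>\<alpha>. (norm (g \<alpha>))\<^sup>2)"
    by (intro integrableI_bounded) (auto simp: order_le_less_trans)
  then show ?thesis using g by (simp add: square_integrable_def)
qed

section \<open>Analysis and synthesis operators\<close>

text \<open>One family at a time: the locale is instantiated at \<open>A\<close> and at
  \<open>\<Psi>\<close>, and only the frame operator involves both.\<close>

locale op_family = hilbert_space H + H0: hilbert_space H0
  for H :: "('k::rc_field, 'h::banach) ip_space" and H0 :: "('k, 'v::banach) ip_space" +
  fixes M :: "'a measure" and A :: "'a \<Rightarrow> 'h \<Rightarrow> 'v"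
  assumes bounded: "\<alpha> \<in> space M \<Longrightarrow> A \<alpha> \<in> bounded_ops H H0"
    and measurable_family: "strongly_measurable M (\<lambda>\<alpha>. A \<alpha> h)"
begin

abbreviation weak_synthesis :: "('a \<Rightarrow> 'v) \<Rightarrow> 'h \<Rightarrow> bool" where
  "weak_synthesis f v \<equiv> has_weak_integral M H (\<lambda>\<alpha>. hadjoint H H0 (A \<alpha>) (f \<alpha>)) v"

abbreviation L2norm :: "('a \<Rightarrow> 'v) \<Rightarrow> real" where
  "L2norm f \<equiv> sqrt (LINT \<alpha>|M. (norm (f \<alpha>))\<^sup>2)"

lemma family_add: "\<alpha> \<in> space M \<Longrightarrow> A \<alpha> (x + y) = A \<alpha> x + A \<alpha> y"
  using bounded by (simp add: bounded_ops_def vecs_UNIV H0.vecs_UNIV vadd_plus H0.vadd_plus)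

lemma family_vscale: "\<alpha> \<in> space M \<Longrightarrow> A \<alpha> (vscale H c x) = vscale H0 c (A \<alpha> x)"
  using bounded by (simp add: bounded_ops_def vecs_UNIV H0.vecs_UNIV)

lemma vinner_hadjoint_family:
  assumes "\<alpha> \<in> space M"
  shows "vinner H (hadjoint H H0 (A \<alpha>) y) x = vinner H0 y (A \<alpha> x)"
proof -
  obtain C where C: "\<And>x. norm (A \<alpha> x) \<le> C * norm x"
    using bounded[OF assms] by (auto simp: bounded_ops_def vecs_UNIV vnorm_eq H0.vnorm_eq)
  have "\<exists>z. \<forall>x. vinner H0 (A \<alpha> x) y = vinner H x z"
  proof (rule riesz_representation)
    show "norm (vinner H0 (A \<alpha> x) y) \<le> (C * norm y) * norm x" for x
      using H0.norm_vinner_le[of "A \<alpha> x" y] mult_right_mono[OF C[of x], of "norm y"]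
      by (simp add: algebra_simps)
  qed (simp_all add: family_add family_vscale assms H0.vinner_add H0.vinner_scale)
  then obtain z where z: "\<And>x. vinner H0 (A \<alpha> x) y = vinner H x z" by blast
  then have "hadjoint H H0 (A \<alpha>) y = z" by (rule hadjoint_eqI)
  then show ?thesis using z by (metis vinner_conj H0.vinner_conj)
qed

text \<open>Moving the adjoint across the inner product leaves an integrand expressed through
  \<alpha> \<mapsto> \<open>A \<alpha> g\<close>, whose measurability is given. Congruence on
  \<open>space M\<close> suffices, which is where the adjoints are under control.\<close>

lemma weak_synthesis_iff:
  "weak_synthesis f v \<longleftrightarrow> (\<forall>g. integrable M (\<lambda>\<alpha>. vinner H0 (f \<alpha>) (A \<alpha> g)) \<and>
     vinner H v g = (LINT \<alpha>|M. vinner H0 (f \<alpha>) (A \<alpha> g)))"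
proof -
  have "integrable M (\<lambda>\<alpha>. vinner H (hadjoint H H0 (A \<alpha>) (f \<alpha>)) g)
      \<longleftrightarrow> integrable M (\<lambda>\<alpha>. vinner H0 (f \<alpha>) (A \<alpha> g))" for g
    by (rule Bochner_Integration.integrable_cong) (simp_all add: vinner_hadjoint_family)
  moreover have "(LINT \<alpha>|M. vinner H (hadjoint H H0 (A \<alpha>) (f \<alpha>)) g)
      = (LINT \<alpha>|M. vinner H0 (f \<alpha>) (A \<alpha> g))" for g
    by (rule Bochner_Integration.integral_cong) (simp_all add: vinner_hadjoint_family)
  ultimately show ?thesis by (simp add: has_weak_integral_def vecs_UNIV)
qed

lemma weak_synthesis_unique: "weak_synthesis f v \<Longrightarrow> weak_synthesis f w \<Longrightarrow> v = w"
  by (rule vinner_eqI') (simp add: weak_synthesis_iff)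

lemma weak_synthesis_cong:
  assumes "f' \<in> L2_class M f" "weak_synthesis f v"
  shows "weak_synthesis f' v"
proof -
  have m: "(\<lambda>\<alpha>. vinner H0 (f \<alpha>) (A \<alpha> g)) \<in> borel_measurable M"
      "(\<lambda>\<alpha>. vinner H0 (f' \<alpha>) (A \<alpha> g)) \<in> borel_measurable M" for g
    using assms(1) measurable_family
    by (auto simp: mem_L2_class square_integrable_def intro!: H0.vinner_borel)
  have "AE \<alpha> in M. vinner H0 (f \<alpha>) (A \<alpha> g) = vinner H0 (f' \<alpha>) (A \<alpha> g)" for g
    using assms(1) by (auto simp: mem_L2_class elim: eventually_mono)
  then show ?thesis using assms(2) m unfolding weak_synthesis_iff
    by (metis integrable_cong_AE integral_cong_AE)
qed

text \<open>\<open>synthesis_wd\<close> asks for one vector serving all representatives of a class.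
  Weak integrals ignore null sets and are unique by nondegeneracy, so existence for a single
  representative is enough.\<close>

lemma synthesis_wd_iff:
  "synthesis_wd M H H0 A \<longleftrightarrow> (\<forall>f\<in>square_integrable M. \<exists>v. weak_synthesis f v)"
proof
  assume wd: "synthesis_wd M H H0 A"
  show "\<forall>f\<in>square_integrable M. \<exists>v. weak_synthesis f v"
  proof
    fix f :: "'a \<Rightarrow> 'v" assume f: "f \<in> square_integrable M"
    then have "L2_class M f \<in> vecs (L2_space M H0)" unfolding vecs_L2_iff by blast
    from ex1_implies_ex[OF bspec[OF wd[unfolded synthesis_wd_def] this]]
    obtain v where "\<forall>f'\<in>L2_class M f. weak_synthesis f' v" ..
    then have "weak_synthesis f v" using L2_class_self[OF f] by (rule bspec)
    then show "\<exists>v. weak_synthesis f v" ..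
  qed
next
  assume R: "\<forall>f\<in>square_integrable M. \<exists>v. weak_synthesis f v"
  show "synthesis_wd M H H0 A" unfolding synthesis_wd_def
  proof
    fix F assume "F \<in> vecs (L2_space M H0)"
    then obtain f where f: "f \<in> square_integrable M" "F = L2_class M f"
      unfolding vecs_L2_iff by blast
    then obtain v where v: "weak_synthesis f v" using R by blast
    show "\<exists>!v. \<forall>f\<in>F. weak_synthesis f v"
    proof (rule ex1I)
      show "\<forall>f\<in>F. weak_synthesis f v"
        unfolding f(2) by (intro ballI weak_synthesis_cong[OF _ v])
      show "w = v" if "\<forall>f\<in>F. weak_synthesis f w" for w
        by (rule weak_synthesis_unique[OF bspec[OF that] v]) (simp add: f L2_class_self)
    qed
  qed
qed

lemma synthesis_op_eqI:
  assumes f: "f \<in> square_integrable M" and v: "weak_synthesis f v"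
  shows "synthesis_op M H H0 A (L2_class M f) = v"
  unfolding synthesis_op_def
proof (rule the_equality)
  show "\<forall>f'\<in>L2_class M f. weak_synthesis f' v" by (intro ballI weak_synthesis_cong[OF _ v])
  show "w = v" if "\<forall>f'\<in>L2_class M f. weak_synthesis f' w" for w
    by (rule weak_synthesis_unique[OF bspec[OF that] v]) (rule L2_class_self[OF f])
qed

lemma weak_synthesis_op:
  assumes "synthesis_wd M H H0 A" "f \<in> square_integrable M"
  shows "weak_synthesis f (synthesis_op M H H0 A (L2_class M f))"
proof -
  obtain v where "weak_synthesis f v" using assms unfolding synthesis_wd_iff by blast
  then show ?thesis using synthesis_op_eqI[OF assms(2)] by simp
qed

lemma vinner_synthesis_op:
  assumes "synthesis_wd M H H0 A" "f \<in> square_integrable M"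
  shows "integrable M (\<lambda>\<alpha>. vinner H0 (f \<alpha>) (A \<alpha> g))"
    and "vinner H (synthesis_op M H H0 A (L2_class M f)) g = (LINT \<alpha>|M. vinner H0 (f \<alpha>) (A \<alpha> g))"
  using weak_synthesis_op[OF assms] unfolding weak_synthesis_iff by blast+

text \<open>Linearity is automatic, by testing the weak integral against all vectors; only the norm
  estimate is left as a condition.\<close>

lemma synthesis_op_bounded_iff:
  assumes wd: "synthesis_wd M H H0 A"
  shows "synthesis_op M H H0 A \<in> bounded_ops (L2_space M H0) H \<longleftrightarrow>
    (\<exists>C. \<forall>f\<in>square_integrable M. norm (synthesis_op M H H0 A (L2_class M f)) \<le> C * L2norm f)"
proof -
  let ?U = "synthesis_op M H H0 A"
  have add: "?U (L2_class M (\<lambda>\<alpha>. f \<alpha> + g \<alpha>)) = ?U (L2_class M f) + ?U (L2_class M g)"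
    if "f \<in> square_integrable M" "g \<in> square_integrable M" for f g
    by (rule vinner_eqI')
      (simp add: vinner_synthesis_op[OF wd] that square_integrable_add vinner_add H0.vinner_add)
  have scale: "?U (L2_class M (\<lambda>\<alpha>. vscale H0 c (f \<alpha>))) = vscale H c (?U (L2_class M f))"
    if "f \<in> square_integrable M" for c f
    by (rule vinner_eqI')
      (simp add: vinner_synthesis_op[OF wd] that H0.square_integrable_vscale vinner_scale H0.vinner_scale)
  show ?thesis
    unfolding bounded_ops_def mem_Collect_eq ball_vecs_L2
    by (simp add: vecs_UNIV H0.vadd_L2 H0.vscale_L2 H0.vnorm_L2 vnorm_eq vadd_plus add scale)
qed

lemma analysis_op_bounded_iff:
  assumes wd: "analysis_wd M A"
  shows "analysis_op M A \<in> bounded_ops H (L2_space M H0) \<longleftrightarrow>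
    (\<exists>C. \<forall>h. L2norm (\<lambda>\<alpha>. A \<alpha> h) \<le> C * norm h)"
proof -
  have sq: "(\<lambda>\<alpha>. A \<alpha> h) \<in> square_integrable M" for h using wd by (simp add: analysis_wd_def)
  have "L2_class M (\<lambda>\<alpha>. A \<alpha> (x + y)) = L2_class M (\<lambda>\<alpha>. A \<alpha> x + A \<alpha> y)" for x y
    by (rule L2_class_eqI) (simp_all add: sq square_integrable_add family_add)
  moreover have "L2_class M (\<lambda>\<alpha>. A \<alpha> (vscale H c x)) = L2_class M (\<lambda>\<alpha>. vscale H0 c (A \<alpha> x))" for c x
    by (rule L2_class_eqI) (simp_all add: sq H0.square_integrable_vscale family_vscale)
  moreover have "L2_class M (\<lambda>\<alpha>. A \<alpha> x) \<in> vecs (L2_space M H0)" for x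
    using sq vecs_L2_iff by blast
  ultimately show ?thesis
    by (simp add: bounded_ops_def analysis_op_def vecs_UNIV H0.vadd_L2 H0.vscale_L2 H0.vnorm_L2
        vnorm_eq vadd_plus sq)
qed

definition bounded_analysis :: bool where
  "bounded_analysis \<longleftrightarrow> analysis_wd M A \<and> analysis_op M A \<in> bounded_ops H (L2_space M H0)"

definition bounded_synthesis :: bool where
  "bounded_synthesis \<longleftrightarrow> synthesis_wd M H H0 A \<and> synthesis_op M H H0 A \<in> bounded_ops (L2_space M H0) H"

lemma bounded_analysisE:
  assumes bounded_analysis
  obtains C where "0 \<le> C" "\<And>h. (\<lambda>\<alpha>. A \<alpha> h) \<in> square_integrable M"
    "\<And>h. L2norm (\<lambda>\<alpha>. A \<alpha> h) \<le> C * norm h"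
proof -
  from assms have wd: "analysis_wd M A" and "\<exists>C. \<forall>h. L2norm (\<lambda>\<alpha>. A \<alpha> h) \<le> C * norm h"
    using analysis_op_bounded_iff unfolding bounded_analysis_def by blast+
  then obtain C where C: "\<And>h. L2norm (\<lambda>\<alpha>. A \<alpha> h) \<le> C * norm h" by blast
  show ?thesis
  proof
    \<comment> \<open>\<open>bounded_ops\<close> puts no sign on the constant, whereas the later
      estimates multiply by it, so it is replaced by its absolute value.\<close>
    show "L2norm (\<lambda>\<alpha>. A \<alpha> h) \<le> \<bar>C\<bar> * norm h" for h
      using order_trans[OF C mult_right_mono[OF abs_ge_self norm_ge_zero]] .
  qed (use wd in \<open>auto simp: analysis_wd_def\<close>)
qed

lemma bounded_analysis_imp_synthesis:
  assumes bounded_analysis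
  shows bounded_synthesis
proof -
  obtain C where C: "0 \<le> C" "\<And>h. (\<lambda>\<alpha>. A \<alpha> h) \<in> square_integrable M"
      "\<And>h. L2norm (\<lambda>\<alpha>. A \<alpha> h) \<le> C * norm h"
    using bounded_analysisE[OF assms] by metis
  have wd: "synthesis_wd M H H0 A" unfolding synthesis_wd_iff
  proof
    fix f :: "'a \<Rightarrow> 'v" assume f: "f \<in> square_integrable M"
    \<comment> \<open>Riesz wants a functional linear in the test vector \<open>g\<close>, so
      \<open>g\<close> sits in the first argument; conjugating the integral afterwards restores the
      order of \<open>weak_synthesis_iff\<close>.\<close>
    have "\<exists>v. \<forall>g. (LINT \<alpha>|M. vinner H0 (A \<alpha> g) (f \<alpha>)) = vinner H g v"
    proof (rule riesz_representation)
      show "(LINT \<alpha>|M. vinner H0 (A \<alpha> (x + y)) (f \<alpha>)) =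
          (LINT \<alpha>|M. vinner H0 (A \<alpha> x) (f \<alpha>)) + (LINT \<alpha>|M. vinner H0 (A \<alpha> y) (f \<alpha>))" for x y
        by (subst Bochner_Integration.integral_add[symmetric])
          (auto intro!: H0.integrable_vinner C f Bochner_Integration.integral_cong
            simp: family_add H0.vinner_add)
      show "(LINT \<alpha>|M. vinner H0 (A \<alpha> (vscale H c x)) (f \<alpha>)) =
          c * (LINT \<alpha>|M. vinner H0 (A \<alpha> x) (f \<alpha>))" for c x
        unfolding integral_mult_right_zero[symmetric]
        by (rule Bochner_Integration.integral_cong) (simp_all add: family_vscale H0.vinner_scale)
      show "norm (LINT \<alpha>|M. vinner H0 (A \<alpha> x) (f \<alpha>)) \<le> (C * L2norm f) * norm x" for x
        using H0.norm_integral_vinner_le[OF C(2)[of x] f] mult_right_mono[OF C(3)[of x], of "L2norm f"]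
        by (simp add: algebra_simps)
    qed
    then obtain v where v: "\<And>g. (LINT \<alpha>|M. vinner H0 (A \<alpha> g) (f \<alpha>)) = vinner H g v" by blast
    have "vinner H v g = (LINT \<alpha>|M. vinner H0 (f \<alpha>) (A \<alpha> g))" for g
    proof -
      have "vinner H v g = conjK (LINT \<alpha>|M. vinner H0 (A \<alpha> g) (f \<alpha>))"
        unfolding v by (rule vinner_conj)
      also have "\<dots> = (LINT \<alpha>|M. conjK (vinner H0 (A \<alpha> g) (f \<alpha>)))"
        by (rule integral_bounded_linear[OF bounded_linear_conjK, symmetric])
          (intro H0.integrable_vinner C f)
      also have "\<dots> = (LINT \<alpha>|M. vinner H0 (f \<alpha>) (A \<alpha> g))"
        unfolding H0.vinner_conj[symmetric] ..
      finally show ?thesis .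
    qed
    then show "\<exists>v. weak_synthesis f v"
      unfolding weak_synthesis_iff using H0.integrable_vinner[OF f C(2)] by blast
  qed
  let ?U = "\<lambda>f. synthesis_op M H H0 A (L2_class M f)"
  \<comment> \<open>Test \<open>?U f\<close> against itself: its squared norm is at most |f| times C
    times its norm, and one factor cancels.\<close>
  have "norm (?U f) \<le> C * L2norm f" if f: "f \<in> square_integrable M" for f
  proof (cases "?U f = 0")
    case False
    have "(norm (?U f))\<^sup>2 = norm (LINT \<alpha>|M. vinner H0 (f \<alpha>) (A \<alpha> (?U f)))"
      unfolding vinner_synthesis_op(2)[OF wd f, symmetric] vinner_self by (simp add: norm_power)
    also have "\<dots> \<le> L2norm f * L2norm (\<lambda>\<alpha>. A \<alpha> (?U f))"
      by (rule H0.norm_integral_vinner_le[OF f C(2)])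
    also have "\<dots> \<le> L2norm f * (C * norm (?U f))"
      by (intro mult_left_mono C) simp
    finally show ?thesis using False by (simp add: power2_eq_square mult_ac)
  qed (use C in simp)
  then show ?thesis using wd synthesis_op_bounded_iff[OF wd] unfolding bounded_synthesis_def by blast
qed

lemma bounded_synthesis_imp_analysis:
  assumes "semifinite M" bounded_synthesis
  shows bounded_analysis
proof -
  let ?U = "\<lambda>f. synthesis_op M H H0 A (L2_class M f)"
  have wd: "synthesis_wd M H H0 A" using assms(2) by (simp add: bounded_synthesis_def)
  then obtain C where C: "\<And>f. f \<in> square_integrable M \<Longrightarrow> norm (?U f) \<le> C * L2norm f"
    using assms(2) synthesis_op_bounded_iff unfolding bounded_synthesis_def by blast
  have bd: "norm (LINT \<alpha>|M. vinner H0 (f \<alpha>) (A \<alpha> h)) \<le> (C * norm h) * L2norm f"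
    if f: "f \<in> square_integrable M" for f h
    using norm_vinner_le[of "?U f" h] mult_right_mono[OF C[OF f], of "norm h"]
    by (simp add: vinner_synthesis_op(2)[OF wd f] algebra_simps)
  have sq: "(\<lambda>\<alpha>. A \<alpha> h) \<in> square_integrable M" for h
    by (rule H0.square_integrable_if_bounded_functional[OF assms(1) measurable_family bd])
  \<comment> \<open>Now that \<alpha> \<mapsto> \<open>A \<alpha> h\<close> is square-integrable, it
    may itself be inserted for \<open>f\<close> in \<open>bd\<close>, giving the square of its norm
    on the left.\<close>
  have "L2norm (\<lambda>\<alpha>. A \<alpha> h) \<le> \<bar>C\<bar> * norm h" for h
  proof (cases "L2norm (\<lambda>\<alpha>. A \<alpha> h) = 0")
    case False
    have "L2norm (\<lambda>\<alpha>. A \<alpha> h) * L2norm (\<lambda>\<alpha>. A \<alpha> h) \<le> (C * norm h) * L2norm (\<lambda>\<alpha>. A \<alpha> h)"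
      using bd[OF sq[of h], of h] by (simp add: H0.integral_vinner_self[OF sq])
    moreover have "0 < L2norm (\<lambda>\<alpha>. A \<alpha> h)" using False by (simp add: less_le)
    ultimately have "L2norm (\<lambda>\<alpha>. A \<alpha> h) \<le> C * norm h" by (rule mult_right_le_imp_le)
    also have "\<dots> \<le> \<bar>C\<bar> * norm h" by (intro mult_right_mono) simp_all
    finally show ?thesis .
  qed simp
  moreover have "analysis_wd M A" using sq by (simp add: analysis_wd_def)
  ultimately show ?thesis unfolding bounded_analysis_def using analysis_op_bounded_iff by blast
qed

lemma hadjoint_synthesis_op:
  assumes bounded_analysis
  shows "hadjoint (L2_space M H0) H (synthesis_op M H H0 A) = analysis_op M A"
proof
  fix h
  have wd: "synthesis_wd M H H0 A"
    using bounded_analysis_imp_synthesis[OF assms] by (simp add: bounded_synthesis_def)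
  have sq: "(\<lambda>\<alpha>. A \<alpha> h) \<in> square_integrable M"
    using assms by (simp add: bounded_analysis_def analysis_wd_def)
  show "hadjoint (L2_space M H0) H (synthesis_op M H H0 A) h = analysis_op M A h"
    unfolding hadjoint_def
  proof (rule the_equality)
    show "analysis_op M A h \<in> vecs (L2_space M H0) \<and> (\<forall>G\<in>vecs (L2_space M H0).
        vinner H (synthesis_op M H H0 A G) h = vinner (L2_space M H0) G (analysis_op M A h))"
      unfolding ball_vecs_L2 using sq
      by (simp add: analysis_op_def L2_class_in_vecs vinner_synthesis_op(2)[OF wd] H0.vinner_L2)
  next
    fix F assume F: "F \<in> vecs (L2_space M H0) \<and> (\<forall>G\<in>vecs (L2_space M H0).
        vinner H (synthesis_op M H H0 A G) h = vinner (L2_space M H0) G F)"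
    then obtain f where f: "f \<in> square_integrable M" "F = L2_class M f"
      unfolding vecs_L2_iff by blast
    have eq: "(LINT \<alpha>|M. vinner H0 (g \<alpha>) (A \<alpha> h)) = (LINT \<alpha>|M. vinner H0 (g \<alpha>) (f \<alpha>))"
      if g: "g \<in> square_integrable M" for g
    proof -
      have "vinner H (synthesis_op M H H0 A (L2_class M g)) h
          = vinner (L2_space M H0) (L2_class M g) (L2_class M f)"
        using F f(2) L2_class_in_vecs[OF g] by blast
      then show ?thesis by (simp add: vinner_synthesis_op(2)[OF wd g] H0.vinner_L2 g f(1))
    qed
    \<comment> \<open>Nondegeneracy of the inner product on classes: by \<open>eq\<close> the
      difference is orthogonal to itself, hence zero almost everywhere, and this is equality of
      classes.\<close>
    let ?d = "\<lambda>\<alpha>. A \<alpha> h - f \<alpha>"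
    have d: "?d \<in> square_integrable M"
      using square_integrable_add[OF sq H0.square_integrable_vscale[OF f(1), of "of_real (-1)"]]
      unfolding H0.vscale_of_real by simp
    have "(LINT \<alpha>|M. vinner H0 (?d \<alpha>) (?d \<alpha>))
        = (LINT \<alpha>|M. vinner H0 (?d \<alpha>) (A \<alpha> h) - vinner H0 (?d \<alpha>) (f \<alpha>))"
      by (simp add: H0.vinner.diff_right)
    also have "\<dots> = 0"
      using eq[OF d] by (subst Bochner_Integration.integral_diff) (auto intro!: H0.integrable_vinner d sq f)
    finally have "(LINT \<alpha>|M. (norm (?d \<alpha>))\<^sup>2) = 0" by (simp add: H0.integral_vinner_self[OF d])
    then have "AE \<alpha> in M. (norm (?d \<alpha>))\<^sup>2 = 0"
      using d by (subst (asm) integral_nonneg_eq_0_iff_AE) (auto simp: square_integrable_def)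
    then have "AE \<alpha> in M. f \<alpha> = A \<alpha> h" by (auto elim: eventually_mono)
    then show "F = analysis_op M A h"
      unfolding f(2) analysis_op_def by (intro L2_class_eqI f sq)
  qed
qed

text \<open>The equation is restricted to genuine classes, as a synthesis operator is specified only
  there. It is therefore used in composition with \<open>R\<close>, whose values are
  classes.\<close>

lemma hadjoint_analysis_op:
  assumes bounded_analysis "F \<in> vecs (L2_space M H0)"
  shows "hadjoint H (L2_space M H0) (analysis_op M A) F = synthesis_op M H H0 A F"
proof (rule hadjoint_eqI)
  fix h
  have wd: "synthesis_wd M H H0 A"
    using bounded_analysis_imp_synthesis[OF assms(1)] by (simp add: bounded_synthesis_def)
  have sq: "(\<lambda>\<alpha>. A \<alpha> h) \<in> square_integrable M"
    using assms(1) by (simp add: bounded_analysis_def analysis_wd_def)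
  obtain f where f: "f \<in> square_integrable M" "F = L2_class M f"
    using assms(2) unfolding vecs_L2_iff by blast
  have "vinner H h (synthesis_op M H H0 A F) = conjK (LINT \<alpha>|M. vinner H0 (f \<alpha>) (A \<alpha> h))"
    unfolding f(2) vinner_synthesis_op(2)[OF wd f(1), symmetric] by (rule vinner_conj)
  also have "\<dots> = (LINT \<alpha>|M. conjK (vinner H0 (f \<alpha>) (A \<alpha> h)))"
    by (rule integral_bounded_linear[OF bounded_linear_conjK, symmetric])
      (intro H0.integrable_vinner sq f)
  also have "\<dots> = vinner (L2_space M H0) (analysis_op M A h) F"
    unfolding analysis_op_def f(2) H0.vinner_L2[OF sq f(1)] H0.vinner_conj[symmetric] ..
  finally show "vinner (L2_space M H0) (analysis_op M A h) F = vinner H h (synthesis_op M H H0 A F)" ..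
qed

end

section \<open>The frame operator and the characterizations\<close>

text \<open>The weak integral defining the frame operator at \<open>h\<close> is the synthesis
  integral of \<open>\<Psi>\<close> at the function \<alpha> \<mapsto> \<open>A \<alpha> h\<close>,
  which is in L2 because the analysis operator of \<open>A\<close> is well-defined.\<close>

lemma frame_op_eq_comp:
  assumes "op_family H H0 M A" "op_family H H0 M \<Psi>"
    and "op_family.bounded_analysis H H0 M A" "op_family.bounded_analysis H H0 M \<Psi>"
  shows "frame_op_wd M H H0 A \<Psi>"
    and "frame_op M H H0 A \<Psi> = synthesis_op M H H0 \<Psi> \<circ> analysis_op M A"
proof -
  interpret A: op_family H H0 M A by fact
  interpret P: op_family H H0 M \<Psi> by fact
  have sq: "(\<lambda>\<alpha>. A \<alpha> h) \<in> square_integrable M" for h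
    using assms(3) by (simp add: A.bounded_analysis_def analysis_wd_def)
  have *: "P.weak_synthesis (\<lambda>\<alpha>. A \<alpha> h) (synthesis_op M H H0 \<Psi> (analysis_op M A h))" for h
    unfolding analysis_op_def using P.bounded_analysis_imp_synthesis[OF assms(4)] sq
    by (intro P.weak_synthesis_op) (simp_all add: P.bounded_synthesis_def)
  show "frame_op_wd M H H0 A \<Psi>"
    unfolding frame_op_wd_def by (intro allI ex1I) (rule *, rule P.weak_synthesis_unique[OF _ *])
  show "frame_op M H H0 A \<Psi> = synthesis_op M H H0 \<Psi> \<circ> analysis_op M A"
    unfolding frame_op_def fun_eq_iff comp_apply
    by (intro allI the_equality) (rule *, rule P.weak_synthesis_unique[OF _ *])
qed

lemma (in hilbert_space) op_le_scalar_imp_coercive: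
  assumes "op_le H (scalar_op H a) T"
  shows "a * (norm x)\<^sup>2 \<le> reK (vinner H (T x) x)"
proof -
  have "0 \<le> reK (vinner H (T x - a *\<^sub>R x) x)"
    using assms by (simp add: op_le_def positive_op_def scalar_op_def vscale_of_real vecs_UNIV)
  then show ?thesis by (simp add: vinner.diff_left reK_diff vinner_scaleR reK_scaleR vinner_self)
qed

text \<open>The remaining Bessel requirements are hidden in \<open>op_le\<close>: it includes
  boundedness and self-adjointness, and comparison with 0 includes positivity.\<close>

lemma continuous_bessel_bound_iff:
  assumes "op_family H H0 M A" "op_family H H0 M \<Psi>"
  shows "continuous_bessel_bound M H H0 A \<Psi> b \<longleftrightarrow>
    op_family.bounded_analysis H H0 M A \<and> op_family.bounded_analysis H H0 M \<Psi> \<and>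
    op_le H (\<lambda>_. 0) (synthesis_op M H H0 \<Psi> \<circ> analysis_op M A) \<and>
    op_le H (synthesis_op M H H0 \<Psi> \<circ> analysis_op M A) (scalar_op H b)" (is "_ \<longleftrightarrow> ?R")
proof -
  interpret A: op_family H H0 M A by fact
  interpret P: op_family H H0 M \<Psi> by fact
  note defs = continuous_bessel_bound_def continuous_bessel_def A.bounded_analysis_def P.bounded_analysis_def
  show ?thesis
  proof
    assume L: "continuous_bessel_bound M H H0 A \<Psi> b"
    then show ?R using frame_op_eq_comp(2)[OF assms] by (simp add: defs)
  next
    assume R: ?R
    then have *: "frame_op_wd M H H0 A \<Psi>"
        "frame_op M H H0 A \<Psi> = synthesis_op M H H0 \<Psi> \<circ> analysis_op M A"
      using frame_op_eq_comp[OF assms] by blast+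
    then have "positive_op H (frame_op M H H0 A \<Psi>)" "frame_op M H H0 A \<Psi> \<in> bounded_ops H H"
      using R by (simp_all add: op_le_def positive_op_def selfadjoint_op_def)
    then show "continuous_bessel_bound M H H0 A \<Psi> b"
      using R * A.bounded P.bounded A.measurable_family P.measurable_family
      by (simp add: defs measurable_op_family_def)
  qed
qed

text \<open>With \<open>0 < a\<close> the lower bound is coercivity, which provides both positivity
  and a bounded inverse, the two frame requirements absent from the right-hand side.\<close>

lemma continuous_ovf_bounds_iff:
  assumes "op_family H H0 M A" "op_family H H0 M \<Psi>" and a: "0 < a"
  shows "continuous_ovf_bounds M H H0 A \<Psi> a b \<longleftrightarrow>
    op_family.bounded_analysis H H0 M A \<and> op_family.bounded_analysis H H0 M \<Psi> \<and>
    op_le H (scalar_op H a) (synthesis_op M H H0 \<Psi> \<circ> analysis_op M A) \<and>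
    op_le H (synthesis_op M H H0 \<Psi> \<circ> analysis_op M A) (scalar_op H b)" (is "_ \<longleftrightarrow> ?R")
proof -
  interpret A: op_family H H0 M A by fact
  interpret P: op_family H H0 M \<Psi> by fact
  let ?T = "frame_op M H H0 A \<Psi>"
  note defs = continuous_ovf_bounds_def continuous_ovf_def continuous_bessel_def
    A.bounded_analysis_def P.bounded_analysis_def
  show ?thesis
  proof
    assume L: "continuous_ovf_bounds M H H0 A \<Psi> a b"
    then show ?R using frame_op_eq_comp(2)[OF assms(1,2)] by (simp add: defs)
  next
    assume R: ?R
    then have *: "frame_op_wd M H H0 A \<Psi>" "?T = synthesis_op M H H0 \<Psi> \<circ> analysis_op M A"
      using frame_op_eq_comp[OF assms(1,2)] by blast+
    with R have sa: "selfadjoint_op H ?T" by (simp add: op_le_def)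
    have "op_le H (scalar_op H a) ?T" using R * by simp
    note co = A.op_le_scalar_imp_coercive[OF this]
    then have "positive_op H ?T"
      using sa a by (auto simp: positive_op_def intro: order_trans[OF _ co])
    moreover have "invertible_op H ?T"
      by (rule A.selfadjoint_coercive_invertible[OF sa a co])
    moreover have "?T \<in> bounded_ops H H" using sa by (simp add: selfadjoint_op_def)
    ultimately show "continuous_ovf_bounds M H H0 A \<Psi> a b"
      using R * A.bounded P.bounded A.measurable_family P.measurable_family
      by (simp add: defs measurable_op_family_def)
  qed
qed

theorem theorem3p1:
  fixes M :: "'a measure"
    and H :: "('k::rc_field, 'h::banach) ip_space"
    and H0 :: "('k, 'v::banach) ip_space"
    and A \<Psi> :: "'a \<Rightarrow> 'h \<Rightarrow> 'v"
    and L2 :: "('k, ('a \<Rightarrow> 'v) set) ip_space"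
    and U V :: "('a \<Rightarrow> 'v) set \<Rightarrow> 'h"
    and R S :: "'h \<Rightarrow> ('a \<Rightarrow> 'v) set"
    and a b :: real
  assumes "hilbert_space H" and "hilbert_space H0"
    and "\<forall>\<alpha>\<in>space M. A \<alpha> \<in> bounded_ops H H0"
    and "\<forall>\<alpha>\<in>space M. \<Psi> \<alpha> \<in> bounded_ops H H0"
    and "\<forall>h. strongly_measurable M (\<lambda>\<alpha>. A \<alpha> h)"
    and "\<forall>h. strongly_measurable M (\<lambda>\<alpha>. \<Psi> \<alpha> h)"
    and "L2 = L2_space M H0"
    and "U = synthesis_op M H H0 A" and "V = synthesis_op M H H0 \<Psi>"
    and "R = analysis_op M A" and "S = analysis_op M \<Psi>"
    and "0 < a"
  shows
    "(semifinite M \<longrightarrow>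
       \<comment> \<open>(i)\<close>
       (continuous_ovf_bounds M H H0 A \<Psi> a b \<longleftrightarrow>
          synthesis_wd M H H0 A \<and> synthesis_wd M H H0 \<Psi> \<and>
          U \<in> bounded_ops L2 H \<and> V \<in> bounded_ops L2 H \<and>
          op_le H (scalar_op H a) (V \<circ> hadjoint L2 H U) \<and>
          op_le H (V \<circ> hadjoint L2 H U) (scalar_op H b)) \<and>
       (continuous_bessel_bound M H H0 A \<Psi> b \<longleftrightarrow>
          synthesis_wd M H H0 A \<and> synthesis_wd M H H0 \<Psi> \<and>
          U \<in> bounded_ops L2 H \<and> V \<in> bounded_ops L2 H \<and>
          op_le H (\<lambda>_. 0) (V \<circ> hadjoint L2 H U) \<and>
          op_le H (V \<circ> hadjoint L2 H U) (scalar_op H b)) \<and>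
       \<comment> \<open>(ii)\<close>
       (continuous_ovf_bounds M H H0 A \<Psi> a b \<longleftrightarrow>
          synthesis_wd M H H0 A \<and> analysis_wd M \<Psi> \<and>
          U \<in> bounded_ops L2 H \<and> S \<in> bounded_ops H L2 \<and>
          op_le H (scalar_op H a) (hadjoint H L2 S \<circ> hadjoint L2 H U) \<and>
          op_le H (hadjoint H L2 S \<circ> hadjoint L2 H U) (scalar_op H b)) \<and>
       (continuous_bessel_bound M H H0 A \<Psi> b \<longleftrightarrow>
          synthesis_wd M H H0 A \<and> analysis_wd M \<Psi> \<and>
          U \<in> bounded_ops L2 H \<and> S \<in> bounded_ops H L2 \<and>
          op_le H (\<lambda>_. 0) (hadjoint H L2 S \<circ> hadjoint L2 H U) \<and>
          op_le H (hadjoint H L2 S \<circ> hadjoint L2 H U) (scalar_op H b)) \<and>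
       \<comment> \<open>(iii)\<close>
       (continuous_ovf_bounds M H H0 A \<Psi> a b \<longleftrightarrow>
          analysis_wd M A \<and> synthesis_wd M H H0 \<Psi> \<and>
          R \<in> bounded_ops H L2 \<and> V \<in> bounded_ops L2 H \<and>
          op_le H (scalar_op H a) (V \<circ> R) \<and>
          op_le H (V \<circ> R) (scalar_op H b)) \<and>
       (continuous_bessel_bound M H H0 A \<Psi> b \<longleftrightarrow>
          analysis_wd M A \<and> synthesis_wd M H H0 \<Psi> \<and>
          R \<in> bounded_ops H L2 \<and> V \<in> bounded_ops L2 H \<and>
          op_le H (\<lambda>_. 0) (V \<circ> R) \<and>
          op_le H (V \<circ> R) (scalar_op H b))) \<and>
     \<comment> \<open>(iv)\<close>
     (continuous_ovf_bounds M H H0 A \<Psi> a b \<longleftrightarrow>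
        analysis_wd M A \<and> analysis_wd M \<Psi> \<and>
        R \<in> bounded_ops H L2 \<and> S \<in> bounded_ops H L2 \<and>
        op_le H (scalar_op H a) (hadjoint H L2 S \<circ> R) \<and>
        op_le H (hadjoint H L2 S \<circ> R) (scalar_op H b)) \<and>
     (continuous_bessel_bound M H H0 A \<Psi> b \<longleftrightarrow>
        analysis_wd M A \<and> analysis_wd M \<Psi> \<and>
        R \<in> bounded_ops H L2 \<and> S \<in> bounded_ops H L2 \<and>
        op_le H (\<lambda>_. 0) (hadjoint H L2 S \<circ> R) \<and>
        op_le H (hadjoint H L2 S \<circ> R) (scalar_op H b))"
proof -
  have fA: "op_family H H0 M A" and fP: "op_family H H0 M \<Psi>"
    using assms(1-6) by (simp_all add: op_family_def op_family_axioms_def)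
  interpret A: op_family H H0 M A by (rule fA)
  interpret P: op_family H H0 M \<Psi> by (rule fP)
  note iffs = continuous_ovf_bounds_iff[OF fA fP \<open>0 < a\<close>, of b] continuous_bessel_bound_iff[OF fA fP, of b]
  have R: "analysis_wd M A \<and> R \<in> bounded_ops H L2 \<longleftrightarrow> A.bounded_analysis"
    and S: "analysis_wd M \<Psi> \<and> S \<in> bounded_ops H L2 \<longleftrightarrow> P.bounded_analysis"
    and U: "synthesis_wd M H H0 A \<and> U \<in> bounded_ops L2 H \<longleftrightarrow> A.bounded_synthesis"
    and V: "synthesis_wd M H H0 \<Psi> \<and> V \<in> bounded_ops L2 H \<longleftrightarrow> P.bounded_synthesis"
    using assms(7-11) by (simp_all add: A.bounded_analysis_def P.bounded_analysis_def
        A.bounded_synthesis_def P.bounded_synthesis_def)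
  have synth: "A.bounded_synthesis \<longleftrightarrow> A.bounded_analysis" "P.bounded_synthesis \<longleftrightarrow> P.bounded_analysis"
    if "semifinite M"
    using that A.bounded_analysis_imp_synthesis A.bounded_synthesis_imp_analysis
      P.bounded_analysis_imp_synthesis P.bounded_synthesis_imp_analysis by blast+
  have U': "hadjoint L2 H U = R" if A.bounded_analysis
    using A.hadjoint_synthesis_op[OF that] assms(7-11) by simp
  have S': "hadjoint H L2 S \<circ> R = V \<circ> R" if A.bounded_analysis P.bounded_analysis
  proof
    fix h
    have "R h \<in> vecs L2"
      using that(1) assms(7-11) L2_class_in_vecs
      by (auto simp: A.bounded_analysis_def analysis_wd_def analysis_op_def)
    then show "(hadjoint H L2 S \<circ> R) h = (V \<circ> R) h"
      using P.hadjoint_analysis_op[OF that(2)] assms(7-11) by simp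
  qed
  have ovf: "continuous_ovf_bounds M H H0 A \<Psi> a b \<longleftrightarrow> A.bounded_analysis \<and> P.bounded_analysis \<and>
      op_le H (scalar_op H a) (V \<circ> R) \<and> op_le H (V \<circ> R) (scalar_op H b)"
    and bes: "continuous_bessel_bound M H H0 A \<Psi> b \<longleftrightarrow> A.bounded_analysis \<and> P.bounded_analysis \<and>
      op_le H (\<lambda>_. 0) (V \<circ> R) \<and> op_le H (V \<circ> R) (scalar_op H b)"
    using iffs assms(7-11) by simp_all
  show ?thesis
    \<comment> \<open>Every characterization makes both analysis operators bounded, through
      \<open>synth\<close> where a synthesis operator occurs; then \<open>U'\<close> and
      \<open>S'\<close> turn all four products into \<open>V \<circ> R\<close>.\<close>
    unfolding ovf bes using R S U V synth U' S' by (smt (verit))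
qed

end
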